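(* Let $\mathcal{M}$ be a von Neumann algebra, $\omega_0$ a normal state on $\mathcal{M}$, let $\{Q^{s,t}:\mathcal{M}\to\mathcal{M}\}$ ($s,t\in\mathbb{R}_+$, $t-s\ge1$) be a Markov process and let $\{\mathfrak{h}^{s,t}:\mathcal{M}\otimes\mathcal{M}\to\mathcal{M}\otimes\mathcal{M}\}$ ($s,t\in\mathbb{R}_+$, $t-s\ge 1$) be a family of ultraweakly continuous unital completely positive linear operators. For $t\ge 1$ put $\varphi_t(x)=\omega_0(Q^{0,t}x)$ and $\psi_t(x)=(\omega_0\otimes\omega_0)(\mathfrak{h}^{0,t}(x\otimes\mathbf{1}))$, $x\in\mathcal{M}$, and put $\varphi_0=\psi_0=\omega_0$. Assume that for all $s,t$ with $t-s\ge 1$: (i) $U\mathfrak{h}^{s,t}=\mathfrak{h}^{s,t}$; (ii) $E_{\psi_s}\mathfrak{h}^{s,t}\mathbf{x}=Q^{s,t}E_{\varphi_t}\mathbf{x}$ for all $\mathbf{x}\in\mathcal{M}\otimes\mathcal{M}$ (for $s\in\{0\}\cup[1,\infty)$, where $\psi_s$ is defined); (iii) $\mathfrak{h}^{s,t}\mathbf{x}=\mathfrak{h}^{s,t}(E_{\psi_t}(\mathbf{x})\otimes\mathbf{1})$ for all $\mathbf{x}\in\mathcal{M}\otimes\mathcal{M}$; and that $$\mathfrak{h}^{s,t}=(Q^{s,\tau}\otimes Q^{s,\tau})\circ\mathfrak{h}^{\tau,t}$$ for all $s,\tau,t\in\mathbb{R}_+$ with $\tau-s\ge1$, $t-\tau\ge1$.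 (Conditions (i)–(iii) force $\varphi_t=\psi_t$; write $\omega_t:=\varphi_t=\psi_t$.) Then the operators $P^{s,t}:\mathcal{M}\to\mathcal{M}\otimes\mathcal{M}$ defined by $P^{s,t}x=\mathfrak{h}^{s,t}(x\otimes\mathbf{1})$ form, together with the initial state $\omega_0$, a quantum quadratic stochastic process of type (B). Moreover, $Q^{s,t}=E_{\omega_s}P^{s,t}$ for all $s\in\{0\}\cup[1,\infty)$ and $t$ with $t-s\ge1$.
   Context: $\mathcal{M}\otimes\mathcal{M}$ is the von Neumann algebra tensor product and $\mathbf{1}$ is the unit of $\mathcal{M}$. $U:\mathcal{M}\otimes\mathcal{M}\to\mathcal{M}\otimes\mathcal{M}$ is the flip, the ultraweakly continuous linear map with $U(x\otimes y)=y\otimes x$. For a normal state $\varphi$ on $\mathcal{M}$, $E_\varphi:\mathcal{M}\otimes\mathcal{M}\to\mathcal{M}$ is the slice map determined by $E_\varphi(a\otimes b)=\varphi(b)a$, extended by linearity and ultraweak continuity. For an ultraweakly continuous completely positive $T:\mathcal{M}\to\mathcal{M}$, $T\otimes T$ is the ultraweakly continuous map on $\mathcal{M}\otimes\mathcal{M}$ with $(T\otimes T)(x\otimes y)=Tx\otimes Ty$. A Markov process on $\mathcal{M}$ is a family $\{Q^{s,t}:\mathcal{M}\to\mathcal{M}: s,t\in\mathbb{R}_+,\ t-s\ge1\}$ of unital, completely positive, ultraweakly continuous linear operators such that $Q^{s,t}=Q^{s,\tau}Q^{\tau,t}$ whenever $\tau-s\ge1$ and $t-\tau\ge1$. A quantum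 quadratic stochastic process of type (B) on $\mathcal{M}$ is a pair $(\{P^{s,t}\},\omega_0)$, where $\omega_0$ is a normal state on $\mathcal{M}$ and $\{P^{s,t}:\mathcal{M}\to\mathcal{M}\otimes\mathcal{M}: s,t\in\mathbb{R}_+,\ t-s\ge1\}$ is a family of ultraweakly continuous, unital, completely positive linear maps with $UP^{s,t}=P^{s,t}$, such that for all $s\in\{0\}\cup[1,\infty)$ and $\tau,t$ with $\tau-s\ge1$, $t-\tau\ge1$ one has $P^{s,t}x=\big(E_{\omega_s}P^{s,\tau}\otimes E_{\omega_s}P^{s,\tau}\big)(P^{\tau,t}x)$ for all $x\in\mathcal{M}$, where $\omega_s(x)=(\omega_0\otimes\omega_0)(P^{0,s}x)$ for $s\ge1$ (and $\omega_s$ at $s=0$ is the initial state $\omega_0$). *)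

theory Defs
  imports "HOL-Analysis.Analysis"
begin

section \<open>Complex Hilbert spaces and their tensor product\<close>

text \<open>
  A complex Hilbert space is given as a complete real inner product space together with a complex
  structure and a complex inner product (linear in the second argument) whose real part is the
  real inner product. In particular norm, topology and completeness are those of the library.
\<close>

class chilbert_space = real_inner + complete_space +
  fixes scaleC :: "complex \<Rightarrow> 'a \<Rightarrow> 'a"  (infixr \<open>*\<^sub>C\<close> 75)
    and cinner :: "'a \<Rightarrow> 'a \<Rightarrow> complex"
  assumes scaleC_add_right: "c *\<^sub>C (x + y) = c *\<^sub>C x + c *\<^sub>C y"
    and scaleC_add_left: "(c + d) *\<^sub>C x = c *\<^sub>C x + d *\<^sub>C x"
    and scaleC_scaleC: "c *\<^sub>C d *\<^sub>C x = (c * d) *\<^sub>C x"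
    and scaleC_of_real: "complex_of_real r *\<^sub>C x = r *\<^sub>R x"
    and cinner_commute: "cinner x y = cnj (cinner y x)"
    and cinner_add_right: "cinner x (y + z) = cinner x y + cinner x z"
    and cinner_scaleC_right: "cinner x (c *\<^sub>C y) = c * cinner x y"
    and Re_cinner: "Re (cinner x y) = inner x y"

text \<open>
  The space \<open>'k\<close> with the bilinear map \<open>tens\<close> is a realisation of the Hilbert space tensor product
  of \<open>'a\<close> and \<open>'b\<close>; this determines it up to a unique unitary that respects simple tensors.
  The simple tensors are stable under complex scaling, so their real span is their complex span.
\<close>

locale hilbert_tensor =
  fixes tens :: "'a::chilbert_space \<Rightarrow> 'b::chilbert_space \<Rightarrow> 'k::chilbert_space"
  assumes tens_add_left: "tens (\<xi> + \<xi>') \<eta> = tens \<xi> \<eta> + tens \<xi>' \<eta>"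
    and tens_add_right: "tens \<xi> (\<eta> + \<eta>') = tens \<xi> \<eta> + tens \<xi> \<eta>'"
    and tens_scaleC_left: "tens (c *\<^sub>C \<xi>) \<eta> = c *\<^sub>C tens \<xi> \<eta>"
    and tens_scaleC_right: "tens \<xi> (c *\<^sub>C \<eta>) = c *\<^sub>C tens \<xi> \<eta>"
    and cinner_tens: "cinner (tens \<xi> \<eta>) (tens \<xi>' \<eta>') = cinner \<xi> \<xi>' * cinner \<eta> \<eta>'"
    and tens_total: "closure (span {tens \<xi> \<eta> | \<xi> \<eta>. True}) = UNIV"


section \<open>Operators and von Neumann algebras\<close>

text \<open>Operators on \<open>'a\<close> are functions of type \<open>'a \<Rightarrow> 'a\<close> satisfying \<open>bounded_clinear\<close>; their product is
  \<open>\<circ>\<close> and the unit is \<open>id\<close>.\<close>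

definition bounded_clinear :: "('a::chilbert_space \<Rightarrow> 'b::chilbert_space) \<Rightarrow> bool" where
  "bounded_clinear x \<longleftrightarrow> bounded_linear x \<and> (\<forall>c \<xi>. x (c *\<^sub>C \<xi>) = c *\<^sub>C x \<xi>)"

definition is_adjoint :: "('a::chilbert_space \<Rightarrow> 'a) \<Rightarrow> ('a \<Rightarrow> 'a) \<Rightarrow> bool" where
  "is_adjoint y x \<longleftrightarrow> (\<forall>\<xi> \<eta>. cinner (y \<xi>) \<eta> = cinner \<xi> (x \<eta>))"

definition op_lincomb ::
  "complex \<Rightarrow> ('a::chilbert_space \<Rightarrow> 'a) \<Rightarrow> complex \<Rightarrow> ('a \<Rightarrow> 'a) \<Rightarrow> 'a \<Rightarrow> 'a" where
  "op_lincomb a x b y = (\<lambda>\<xi>. a *\<^sub>C x \<xi> + b *\<^sub>C y \<xi>)"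

definition ultraweak_functional :: "(('a::chilbert_space \<Rightarrow> 'a) \<Rightarrow> complex) \<Rightarrow> bool" where
  "ultraweak_functional f \<longleftrightarrow>
     (\<exists>\<xi> \<eta>. summable (\<lambda>n. (norm (\<xi> n))\<^sup>2) \<and> summable (\<lambda>n. (norm (\<eta> n))\<^sup>2) \<and>
        f = (\<lambda>x. \<Sum>n. cinner (\<xi> n) (x (\<eta> n :: 'a))))"

text \<open>The (relative) ultraweak topology on a set \<open>A\<close> of bounded operators.\<close>

definition ultraweak_topology :: "('a::chilbert_space \<Rightarrow> 'a) set \<Rightarrow> ('a \<Rightarrow> 'a) topology" where
  "ultraweak_topology A =
     topology_generated_by {{x \<in> A. f x \<in> V} | f V. ultraweak_functional f \<and> open V}"

text \<open>A von Neumann algebra is an ultraweakly closed unital *-subalgebra of the algebra of all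
  bounded operators.\<close>

definition vn_algebra :: "('a::chilbert_space \<Rightarrow> 'a) set \<Rightarrow> bool" where
  "vn_algebra M \<longleftrightarrow>
     M \<subseteq> Collect bounded_clinear \<and>
     id \<in> M \<and>
     (\<forall>x\<in>M. \<forall>y\<in>M. \<forall>a b. op_lincomb a x b y \<in> M) \<and>
     (\<forall>x\<in>M. \<forall>y\<in>M. x \<circ> y \<in> M) \<and>
     (\<forall>x\<in>M. \<exists>y\<in>M. is_adjoint y x) \<and>
     closedin (ultraweak_topology (Collect bounded_clinear)) M"

definition op_tensor ::
  "('a::chilbert_space \<Rightarrow> 'b::chilbert_space \<Rightarrow> 'k::chilbert_space) \<Rightarrow>
   ('a \<Rightarrow> 'a) \<Rightarrow> ('b \<Rightarrow> 'b) \<Rightarrow> 'k \<Rightarrow> 'k" where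
  "op_tensor tens x y =
     (THE z. bounded_clinear z \<and> (\<forall>\<xi> \<eta>. z (tens \<xi> \<eta>) = tens (x \<xi>) (y \<eta>)))"

text \<open>The von Neumann algebra tensor product is the von Neumann algebra generated by the
  elementary tensors.\<close>

definition vn_tensor ::
  "('a::chilbert_space \<Rightarrow> 'b::chilbert_space \<Rightarrow> 'k::chilbert_space) \<Rightarrow>
   ('a \<Rightarrow> 'a) set \<Rightarrow> ('b \<Rightarrow> 'b) set \<Rightarrow> ('k \<Rightarrow> 'k) set" where
  "vn_tensor tens M N = vn_algebra hull {op_tensor tens x y | x y. x \<in> M \<and> y \<in> N}"


section \<open>Maps between von Neumann algebras\<close>

text \<open>Only the values of a map on its domain algebra \<open>A\<close> matter in the following notions.\<close>

definition uw_linear_map ::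
  "('a::chilbert_space \<Rightarrow> 'a) set \<Rightarrow> ('b::chilbert_space \<Rightarrow> 'b) set \<Rightarrow>
   (('a \<Rightarrow> 'a) \<Rightarrow> ('b \<Rightarrow> 'b)) \<Rightarrow> bool" where
  "uw_linear_map A B T \<longleftrightarrow>
     T \<in> A \<rightarrow> B \<and>
     (\<forall>x\<in>A. \<forall>y\<in>A. \<forall>a b. T (op_lincomb a x b y) = op_lincomb a (T x) b (T y)) \<and>
     continuous_map (ultraweak_topology A) (ultraweak_topology B) T"

definition uw_linear_functional ::
  "('a::chilbert_space \<Rightarrow> 'a) set \<Rightarrow> (('a \<Rightarrow> 'a) \<Rightarrow> complex) \<Rightarrow> bool" where
  "uw_linear_functional A f \<longleftrightarrow>
     (\<forall>x\<in>A. \<forall>y\<in>A. \<forall>a b. f (op_lincomb a x b y) = a * f x + b * f y) \<and>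
     continuous_map (ultraweak_topology A) euclidean f"

text \<open>Positivity of the operator matrix \<open>(x i j)\<close>, \<open>i, j < n\<close>, on the \<open>n\<close>-fold direct sum of \<open>'a\<close>.\<close>

definition positive_op_matrix :: "nat \<Rightarrow> (nat \<Rightarrow> nat \<Rightarrow> 'a::chilbert_space \<Rightarrow> 'a) \<Rightarrow> bool" where
  "positive_op_matrix n x \<longleftrightarrow>
     (\<forall>\<xi>. (\<Sum>i<n. \<Sum>j<n. cinner (\<xi> i) (x i j (\<xi> j))) \<in> \<real>\<^sub>\<ge>\<^sub>0)"

definition completely_positive ::
  "('a::chilbert_space \<Rightarrow> 'a) set \<Rightarrow> (('a \<Rightarrow> 'a) \<Rightarrow> ('b::chilbert_space \<Rightarrow> 'b)) \<Rightarrow> bool" where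
  "completely_positive A T \<longleftrightarrow>
     (\<forall>n x. (\<forall>i<n. \<forall>j<n. x i j \<in> A) \<longrightarrow> positive_op_matrix n x \<longrightarrow>
        positive_op_matrix n (\<lambda>i j. T (x i j)))"

definition normal_ucp ::
  "('a::chilbert_space \<Rightarrow> 'a) set \<Rightarrow> ('b::chilbert_space \<Rightarrow> 'b) set \<Rightarrow>
   (('a \<Rightarrow> 'a) \<Rightarrow> ('b \<Rightarrow> 'b)) \<Rightarrow> bool" where
  "normal_ucp A B T \<longleftrightarrow> uw_linear_map A B T \<and> T id = id \<and> completely_positive A T"

definition normal_state ::
  "('a::chilbert_space \<Rightarrow> 'a) set \<Rightarrow> (('a \<Rightarrow> 'a) \<Rightarrow> complex) \<Rightarrow> bool" where
  "normal_state M \<phi> \<longleftrightarrow>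
     uw_linear_functional M \<phi> \<and> \<phi> id = 1 \<and>
     (\<forall>x\<in>M. (\<forall>\<xi>. cinner \<xi> (x \<xi>) \<in> \<real>\<^sub>\<ge>\<^sub>0) \<longrightarrow> \<phi> x \<in> \<real>\<^sub>\<ge>\<^sub>0)"

text \<open>
  The following four maps on the tensor square of \<open>M\<close> are determined by their values on elementary
  tensors together with linearity and ultraweak continuity. The clause \<open>extensional\<close> fixes the
  irrelevant values outside the tensor square, so that the description is definite.
\<close>

definition flip ::
  "('a::chilbert_space \<Rightarrow> 'a \<Rightarrow> 'k::chilbert_space) \<Rightarrow> ('a \<Rightarrow> 'a) set \<Rightarrow> ('k \<Rightarrow> 'k) \<Rightarrow> 'k \<Rightarrow> 'k" where
  "flip tens M = (THE U.
     U \<in> extensional (vn_tensor tens M M) \<and>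
     uw_linear_map (vn_tensor tens M M) (vn_tensor tens M M) U \<and>
     (\<forall>x\<in>M. \<forall>y\<in>M. U (op_tensor tens x y) = op_tensor tens y x))"

definition slice_map ::
  "('a::chilbert_space \<Rightarrow> 'a \<Rightarrow> 'k::chilbert_space) \<Rightarrow> ('a \<Rightarrow> 'a) set \<Rightarrow>
   (('a \<Rightarrow> 'a) \<Rightarrow> complex) \<Rightarrow> ('k \<Rightarrow> 'k) \<Rightarrow> 'a \<Rightarrow> 'a" where
  "slice_map tens M \<phi> = (THE E.
     E \<in> extensional (vn_tensor tens M M) \<and>
     uw_linear_map (vn_tensor tens M M) M E \<and>
     (\<forall>a\<in>M. \<forall>b\<in>M. E (op_tensor tens a b) = (\<lambda>\<xi>. \<phi> b *\<^sub>C a \<xi>)))"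

definition map_tensor ::
  "('a::chilbert_space \<Rightarrow> 'a \<Rightarrow> 'k::chilbert_space) \<Rightarrow> ('a \<Rightarrow> 'a) set \<Rightarrow>
   (('a \<Rightarrow> 'a) \<Rightarrow> ('a \<Rightarrow> 'a)) \<Rightarrow> ('k \<Rightarrow> 'k) \<Rightarrow> 'k \<Rightarrow> 'k" where
  "map_tensor tens M T = (THE R.
     R \<in> extensional (vn_tensor tens M M) \<and>
     uw_linear_map (vn_tensor tens M M) (vn_tensor tens M M) R \<and>
     (\<forall>x\<in>M. \<forall>y\<in>M. R (op_tensor tens x y) = op_tensor tens (T x) (T y)))"

definition state_tensor ::
  "('a::chilbert_space \<Rightarrow> 'a \<Rightarrow> 'k::chilbert_space) \<Rightarrow> ('a \<Rightarrow> 'a) set \<Rightarrow>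
   (('a \<Rightarrow> 'a) \<Rightarrow> complex) \<Rightarrow> ('k \<Rightarrow> 'k) \<Rightarrow> complex" where
  "state_tensor tens M \<phi> = (THE f.
     f \<in> extensional (vn_tensor tens M M) \<and>
     uw_linear_functional (vn_tensor tens M M) f \<and>
     (\<forall>x\<in>M. \<forall>y\<in>M. f (op_tensor tens x y) = \<phi> x * \<phi> y))"


section \<open>Markov processes and quantum quadratic stochastic processes\<close>

definition markov_process ::
  "('a::chilbert_space \<Rightarrow> 'a) set \<Rightarrow> (real \<Rightarrow> real \<Rightarrow> ('a \<Rightarrow> 'a) \<Rightarrow> 'a \<Rightarrow> 'a) \<Rightarrow> bool" where
  "markov_process M Q \<longleftrightarrow>
     (\<forall>s t. 0 \<le> s \<longrightarrow> 1 \<le> t - s \<longrightarrow> normal_ucp M M (Q s t)) \<and>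
     (\<forall>s \<tau> t. 0 \<le> s \<longrightarrow> 1 \<le> \<tau> - s \<longrightarrow> 1 \<le> t - \<tau> \<longrightarrow>
        (\<forall>x\<in>M. Q s t x = Q s \<tau> (Q \<tau> t x)))"

text \<open>The state at time \<open>s\<close>; it is meaningful only for \<open>s = 0\<close> and \<open>s \<ge> 1\<close>.\<close>

definition qqsp_state ::
  "('a::chilbert_space \<Rightarrow> 'a \<Rightarrow> 'k::chilbert_space) \<Rightarrow> ('a \<Rightarrow> 'a) set \<Rightarrow>
   (real \<Rightarrow> real \<Rightarrow> ('a \<Rightarrow> 'a) \<Rightarrow> 'k \<Rightarrow> 'k) \<Rightarrow> (('a \<Rightarrow> 'a) \<Rightarrow> complex) \<Rightarrow>
   real \<Rightarrow> ('a \<Rightarrow> 'a) \<Rightarrow> complex" where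
  "qqsp_state tens M P \<omega>\<^sub>0 s =
     (if s = 0 then \<omega>\<^sub>0 else (\<lambda>x. state_tensor tens M \<omega>\<^sub>0 (P 0 s x)))"

definition qqsp_type_B ::
  "('a::chilbert_space \<Rightarrow> 'a \<Rightarrow> 'k::chilbert_space) \<Rightarrow> ('a \<Rightarrow> 'a) set \<Rightarrow>
   (real \<Rightarrow> real \<Rightarrow> ('a \<Rightarrow> 'a) \<Rightarrow> 'k \<Rightarrow> 'k) \<Rightarrow> (('a \<Rightarrow> 'a) \<Rightarrow> complex) \<Rightarrow> bool" where
  "qqsp_type_B tens M P \<omega>\<^sub>0 \<longleftrightarrow>
     normal_state M \<omega>\<^sub>0 \<and>
     (\<forall>s t. 0 \<le> s \<longrightarrow> 1 \<le> t - s \<longrightarrow>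
        normal_ucp M (vn_tensor tens M M) (P s t) \<and>
        (\<forall>x\<in>M. flip tens M (P s t x) = P s t x)) \<and>
     (\<forall>s\<in>{0} \<union> {1..}. \<forall>\<tau> t. 1 \<le> \<tau> - s \<longrightarrow> 1 \<le> t - \<tau> \<longrightarrow>
        (\<forall>x\<in>M. P s t x =
           map_tensor tens M
             (\<lambda>y. slice_map tens M (qqsp_state tens M P \<omega>\<^sub>0 s) (P s \<tau> y)) (P \<tau> t x)))"

end

theory Submission
  imports Defs
begin

text \<open>
  The Chapman--Kolmogorov equation of type (B) is the factorisation \<open>h s t = (Q s \<tau> \<otimes> Q s \<tau>) \<circ> h \<tau> t\<close> of the
  hypothesis in disguise: the point is that the operators
  \<open>y \<mapsto> E\<^bsub>\<omega> s\<^esub> (P s \<tau> y)\<close> of the process are exactly the operators \<open>Q s \<tau>\<close>. Indeed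
  \<open>P s \<tau> y = h s \<tau> (y \<otimes> 1)\<close>, condition (ii) turns \<open>E\<^bsub>\<psi> s\<^esub> (h s \<tau> (y \<otimes> 1))\<close> into
  \<open>Q s \<tau> (E\<^bsub>\<phi> \<tau>\<^esub> (y \<otimes> 1))\<close>, and \<open>E\<^bsub>\<phi> \<tau>\<^esub> (y \<otimes> 1) = \<phi> \<tau> 1 \<cdot> y = y\<close> because \<open>\<phi> \<tau>\<close> is unital. Applying
  \<open>\<omega>\<^sub>0\<close> to the same identity at \<open>s = 0\<close>, and using \<open>\<omega>\<^sub>0 \<circ> E\<^bsub>\<omega>\<^sub>0\<^esub> = \<omega>\<^sub>0 \<otimes> \<omega>\<^sub>0\<close>, gives \<open>\<phi> t = \<psi> t\<close>. The
  flip invariance of \<open>P\<close> is condition (i). As \<open>map_tensor tens M T\<close> depends only on the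
  values of \<open>T\<close> on \<open>M\<close>, replacing \<open>y \<mapsto> E\<^bsub>\<omega> s\<^esub> (P s \<tau> y)\<close> by \<open>Q s \<tau>\<close> is a mere congruence
  (\<open>map_tensor_cong\<close>).
  
  What this argument takes for granted is operator theory, developed from the definitions of a Hilbert
  space and of its tensor square. Three facts carry it.
  
  \<^item> Slice maps exist and are unique (\<open>ex1_slice_map\<close>). A normal functional on \<open>M\<close>
    extends to a functional \<open>\<Sum>n. \<langle>\<xi> n, \<cdot> \<eta> n\<rangle>\<close> on all operators (\<open>uw_linear_functional_extend\<close>), and
    then \<open>\<langle>\<alpha>, E z \<beta>\<rangle> = (\<Sum>n. \<langle>\<alpha> \<otimes> \<xi> n, z (\<beta> \<otimes> \<eta> n)\<rangle>)\<close> defines the slice map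
    (\<open>slice_operator\<close>).
  
  \<^item> Ultraweakly continuous linear maps on \<open>M \<otimes> M\<close> are determined by elementary tensors
    (\<open>vn_tensor_induct\<close>): the smallest ultraweakly closed subspace containing the elementary tensors is
    stable under products and adjoints, hence is the von Neumann algebra \<open>M \<otimes> M\<close>.
  
  \<^item> The amplification \<open>x \<mapsto> x \<otimes> 1\<close> is a normal unital completely positive map
    (\<open>normal_ucp_amplification\<close>), so that \<open>P s t\<close> is one. Everything about it is reduced, by
    orthogonalising second legs, to sums \<open>\<Sum>e. A e \<otimes> e\<close> over finitely many orthogonal vectors \<open>e\<close>, on which
    \<open>x \<otimes> 1\<close> acts diagonally.
\<close>


section \<open>Complex Hilbert spaces\<close>

lemma scaleC_one [simp]: "1 *\<^sub>C x = (x::'a::chilbert_space)"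
  using scaleC_of_real[of 1 x] by simp

lemma scaleC_zero_left [simp]: "0 *\<^sub>C x = (0::'a::chilbert_space)"
  using scaleC_of_real[of 0 x] by simp

lemma scaleC_minus1: "(-1) *\<^sub>C x = - (x::'a::chilbert_space)"
  using scaleC_of_real[of "-1" x] by simp

lemma scaleR_scaleC: "r *\<^sub>R x = complex_of_real r *\<^sub>C (x::'a::chilbert_space)"
  by (simp add: scaleC_of_real)

lemma scaleC_zero_right [simp]: "c *\<^sub>C (0::'a::chilbert_space) = 0"
  using scaleC_add_right[of c 0 0] by simp

lemma cinner_zero_right [simp]: "cinner x (0::'a::chilbert_space) = 0"
  using cinner_add_right[of x 0 0] by simp

lemma cinner_add_left: "cinner (x + y) z = cinner x z + cinner y (z::'a::chilbert_space)"
  using cinner_commute[of "x + y" z] cinner_commute[of x z] cinner_commute[of y z]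
  by (simp add: cinner_add_right)

lemma cinner_scaleC_left: "cinner (c *\<^sub>C x) y = cnj c * cinner x (y::'a::chilbert_space)"
  using cinner_commute[of "c *\<^sub>C x" y] cinner_commute[of x y]
  by (simp add: cinner_scaleC_right)

lemma cinner_zero_left [simp]: "cinner (0::'a::chilbert_space) x = 0"
  using cinner_add_left[of 0 0 x] by simp

lemma cinner_minus_right: "cinner x (- y) = - cinner x (y::'a::chilbert_space)"
  using cinner_scaleC_right[of x "-1" y] by (simp add: scaleC_minus1)

lemma cinner_diff_right: "cinner x (y - z) = cinner x y - cinner x (z::'a::chilbert_space)"
  using cinner_add_right[of x y "-z"] by (simp add: cinner_minus_right)

lemma cinner_sum_right: "cinner x (\<Sum>i\<in>I. f i) = (\<Sum>i\<in>I. cinner x (f i :: 'a::chilbert_space))"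
  by (induction I rule: infinite_finite_induct) (auto simp: cinner_add_right)

lemma cinner_sum_left: "cinner (\<Sum>i\<in>I. f i) x = (\<Sum>i\<in>I. cinner (f i :: 'a::chilbert_space) x)"
  by (induction I rule: infinite_finite_induct) (auto simp: cinner_add_left)

lemma cinner_self: "cinner x x = complex_of_real ((norm (x::'a::chilbert_space))\<^sup>2)"
proof (rule complex_eqI)
  show "Re (cinner x x) = Re (complex_of_real ((norm x)\<^sup>2))"
    by (simp add: Re_cinner power2_norm_eq_inner)
  show "Im (cinner x x) = Im (complex_of_real ((norm x)\<^sup>2))"
    using arg_cong[OF cinner_commute[of x x], of Im] by simp
qed

lemma norm_scaleC: "norm (c *\<^sub>C x) = cmod c * norm (x::'a::chilbert_space)"
proof -
  have "complex_of_real ((norm (c *\<^sub>C x))\<^sup>2) = (c * cnj c) * cinner x x"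
    unfolding cinner_self[symmetric] by (simp add: cinner_scaleC_left cinner_scaleC_right mult_ac)
  also have "\<dots> = complex_of_real ((cmod c * norm x)\<^sup>2)"
    by (simp only: cinner_self complex_norm_square[symmetric] of_real_mult[symmetric] power_mult_distrib)
  finally have "(norm (c *\<^sub>C x))\<^sup>2 = (cmod c * norm x)\<^sup>2"
    by (simp only: of_real_eq_iff)
  then show ?thesis by (simp add: power2_eq_iff_nonneg)
qed

lemma norm_cinner_le: "cmod (cinner x y) \<le> norm x * norm (y::'a::chilbert_space)"
proof (cases "cinner x y = 0")
  case False
  \<comment> \<open>A phase \<open>c\<close> that makes the inner product real, so that the real inequality applies.\<close>
  define c where "c = cnj (cinner x y) / cmod (cinner x y)"
  have "c * cinner x y = complex_of_real (cmod (cinner x y))"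
    using False complex_norm_square[of "cinner x y"]
    by (simp add: c_def field_simps power2_eq_square)
  then have "cmod (cinner x y) = Re (cinner x (c *\<^sub>C y))"
    by (simp add: cinner_scaleC_right)
  also have "\<dots> \<le> norm x * norm (c *\<^sub>C y)"
    by (simp add: Re_cinner norm_cauchy_schwarz)
  also have "norm (c *\<^sub>C y) = norm y"
    using False by (simp add: norm_scaleC c_def norm_divide)
  finally show ?thesis .
qed simp

lemma bounded_linear_scaleC: "bounded_linear (\<lambda>x::'a::chilbert_space. c *\<^sub>C x)"
  by (rule bounded_linear_intro[where K = "cmod c"])
    (simp_all add: scaleC_add_right scaleR_scaleC scaleC_scaleC norm_scaleC mult.commute)

lemma bounded_bilinear_cinner: "bounded_bilinear (cinner :: 'a::chilbert_space \<Rightarrow> 'a \<Rightarrow> complex)"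
proof
  show "\<exists>K. \<forall>a b. norm (cinner a b) \<le> norm a * norm (b::'a) * K"
    by (rule exI[of _ 1]) (simp add: norm_cinner_le)
qed (simp_all add: cinner_add_left cinner_add_right scaleR_scaleC cinner_scaleC_left
     cinner_scaleC_right scaleR_conv_of_real)

lemma cinner_ext: "(\<And>a. cinner a x = cinner a y) \<Longrightarrow> x = (y::'a::chilbert_space)"
proof -
  assume "\<And>a. cinner a x = cinner a y"
  then have "cinner (x - y) (x - y) = 0" by (simp add: cinner_diff_right)
  then show ?thesis by (simp add: cinner_self)
qed

lemma bounded_clinearI:
  assumes "\<And>x y. T (x + y) = T x + T y" "\<And>c x. T (c *\<^sub>C x) = c *\<^sub>C T x"
    "\<And>x. norm (T x) \<le> K * norm x"
  shows "bounded_clinear T"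
  unfolding bounded_clinear_def using assms
  by (auto intro!: bounded_linear_intro[where K = K] simp: scaleR_scaleC mult.commute)

lemma bounded_clinear_id: "bounded_clinear id"
  by (rule bounded_clinearI[of _ 1]) auto

lemma bounded_clinear_comp:
  "bounded_clinear x \<Longrightarrow> bounded_clinear y \<Longrightarrow> bounded_clinear (x \<circ> y)"
  by (auto simp: bounded_clinear_def o_def intro: bounded_linear_compose)

lemma bounded_clinear_lincomb:
  "bounded_clinear x \<Longrightarrow> bounded_clinear y \<Longrightarrow> bounded_clinear (op_lincomb a x b y)"
  unfolding bounded_clinear_def op_lincomb_def
  by (auto intro!: bounded_linear_add bounded_linear_compose[OF bounded_linear_scaleC]
      simp: scaleC_add_right scaleC_scaleC mult.commute)

lemma bounded_clinear_add: "bounded_clinear T \<Longrightarrow> T (x + y) = T x + T y"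
  by (simp add: bounded_clinear_def linear_add bounded_linear.linear)

lemma bounded_clinear_scaleC: "bounded_clinear T \<Longrightarrow> T (c *\<^sub>C x) = c *\<^sub>C T x"
  by (simp add: bounded_clinear_def)

lemma bounded_clinear_bound:
  assumes "bounded_clinear T"
  obtains K where "K \<ge> 0" "\<And>x. norm (T x) \<le> K * norm x"
  using bounded_linear.nonneg_bounded[of T] assms
  by (auto simp: bounded_clinear_def mult.commute)

lemma bounded_clinear_tendsto:
  "bounded_clinear T \<Longrightarrow> (f \<longlongrightarrow> l) F \<Longrightarrow> ((\<lambda>n. T (f n)) \<longlongrightarrow> T l) F"
  by (auto simp: bounded_clinear_def intro: bounded_linear.tendsto)

lemma bounded_clinear_sum: "bounded_clinear T \<Longrightarrow> T (\<Sum>i\<in>I. f i) = (\<Sum>i\<in>I. T (f i))"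
  by (simp add: bounded_clinear_def bounded_linear.linear linear_sum)

text \<open>
  The Riesz representation theorem. The vector representing \<open>f\<close> minimises the energy
  \<open>J v = \<parallel>v\<parallel>\<^sup>2 / 2 - f v\<close>: the parallelogram law makes a minimising sequence Cauchy, and the derivative
  of \<open>J\<close> vanishes at its limit.
\<close>
lemma riesz_real:
  fixes f :: "'a::{real_inner,complete_space} \<Rightarrow> real"
  assumes "bounded_linear f"
  shows "\<exists>v. \<forall>x. f x = inner v x"
proof -
  interpret f: bounded_linear f by fact
  define J where "J = (\<lambda>x. (norm x)\<^sup>2 / 2 - f x)"
  obtain K where K: "\<And>x. norm (f x) \<le> norm x * K" using f.bounded by blast
  have low: "J x \<ge> - K\<^sup>2 / 2" for x
  proof -
    have "0 \<le> (norm x - K)\<^sup>2" by simp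
    then have "norm x * K \<le> (norm x)\<^sup>2 / 2 + K\<^sup>2 / 2"
      by (simp add: power2_diff algebra_simps)
    then show ?thesis using K[of x] by (simp add: J_def abs_le_iff)
  qed
  define r where "r = (\<lambda>n. inverse (real (Suc n)))"
  define m where "m = Inf (range J)"
  have bdd: "bdd_below (range J)" using low by (auto intro!: bdd_belowI)
  have m_le: "m \<le> J x" for x unfolding m_def by (rule cInf_lower[OF _ bdd]) auto
  have "\<exists>x. J x < m + r n" for n
    using cInf_lessD[of "range J" "m + r n"] unfolding m_def by (auto simp: r_def)
  then obtain X where X: "\<And>n. J (X n) < m + r n" by metis
  have par: "(norm (x - y))\<^sup>2 = 4 * (J x + J y - 2 * J ((1/2) *\<^sub>R (x + y)))" for x y
    by (simp add: J_def power2_norm_eq_inner inner_diff_left inner_diff_right inner_add_left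
        inner_add_right inner_commute f.add f.scaleR field_simps)
  have dist: "(norm (X i - X j))\<^sup>2 \<le> 4 * (r i + r j)" for i j
    using par[of "X i" "X j"] X[of i] X[of j] m_le[of "(1/2) *\<^sub>R (X i + X j)"] by simp
  have "Cauchy X"
  proof (rule CauchyI)
    fix e :: real assume e: "e > 0"
    then obtain N where N: "r N < e\<^sup>2 / 8"
      using reals_Archimedean[of "e\<^sup>2 / 8"] by (auto simp: r_def)
    have "norm (X i - X j) < e" if "i \<ge> N" "j \<ge> N" for i j
    proof -
      have "r i \<le> r N"
        "r j \<le> r N" using that by (auto simp: r_def intro!: le_imp_inverse_le)
      then have "(norm (X i - X j))\<^sup>2 < e\<^sup>2" using dist[of i j] N by simp
      then show ?thesis using e by (simp add: power_less_imp_less_base)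
    qed
    then show "\<exists>M. \<forall>m\<ge>M. \<forall>n\<ge>M. norm (X m - X n) < e" by blast
  qed
  then obtain v where v: "X \<longlonglongrightarrow> v" using Cauchy_convergent convergent_def by blast
  have "(\<lambda>n. J (X n)) \<longlonglongrightarrow> J v"
    unfolding J_def by (intro tendsto_intros f.tendsto v) auto
  moreover have "(\<lambda>n. m + r n) \<longlonglongrightarrow> m + 0"
    unfolding r_def by (intro tendsto_intros LIMSEQ_inverse_real_of_nat)
  ultimately have Jv: "J v \<le> m"
    using X by (intro LIMSEQ_le[of "\<lambda>n. J (X n)" "J v" _ m]) (auto intro: less_imp_le)
  have "f y = inner v y" for y
  proof (rule ccontr)
    assume ne: "f y \<noteq> inner v y"
    define d where "d = f y - inner v y"
    have y0: "norm y > 0" using ne by auto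
    \<comment> \<open>The minimum of \<open>J\<close> on the line through \<open>v\<close> in direction \<open>y\<close> would lie below \<open>m\<close>.\<close>
    define t where "t = d / (norm y)\<^sup>2"
    have "(norm (v + t *\<^sub>R y))\<^sup>2 = (norm v)\<^sup>2 + 2 * t * inner v y + t\<^sup>2 * (norm y)\<^sup>2"
      unfolding power2_norm_eq_inner
      by (simp add: inner_add_left inner_add_right inner_commute power2_eq_square algebra_simps)
    then have "J (v + t *\<^sub>R y) = J v - t * d + t\<^sup>2 * (norm y)\<^sup>2 / 2"
      by (simp add: J_def d_def f.add f.scaleR field_simps)
    also have "\<dots> = J v - d\<^sup>2 / (norm y)\<^sup>2 / 2"
      using y0 by (simp add: t_def power2_eq_square field_simps)
    also have "\<dots> < J v" using y0 ne by (simp add: d_def)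
    finally show False using Jv m_le[of "v + t *\<^sub>R y"] by simp
  qed
  then show ?thesis by blast
qed

text \<open>
  Every operator below that is not given by a formula on vectors is obtained from its matrix
  coefficients in this way: adjoints, and the values of slice maps. Representing the real part of
  \<open>a \<mapsto> B a b\<close> suffices, as the imaginary part is the real part at \<open>\<i> a\<close>.
\<close>
lemma riesz_sesquilinear:
  fixes B :: "'a::chilbert_space \<Rightarrow> 'b::chilbert_space \<Rightarrow> complex"
  assumes add1: "\<And>a a' b. B (a + a') b = B a b + B a' b"
    and sc1: "\<And>c a b. B (c *\<^sub>C a) b = cnj c * B a b"
    and add2: "\<And>a b b'. B a (b + b') = B a b + B a b'"
    and sc2: "\<And>c a b. B a (c *\<^sub>C b) = c * B a b"
    and "K \<ge> 0" and bd: "\<And>a b. cmod (B a b) \<le> K * norm a * norm b"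
  shows "\<exists>T. bounded_clinear T \<and> (\<forall>a b. cinner a (T b) = B a b)"
proof -
  have "\<exists>v. \<forall>a. cinner a v = B a b" for b
  proof -
    have "bounded_linear (\<lambda>a. Re (B a b))"
    proof (rule bounded_linear_intro[where K = "K * norm b"])
      show "norm (Re (B x b)) \<le> norm x * (K * norm b)" for x
        using abs_Re_le_cmod[of "B x b"] bd[of x b] by (simp add: mult_ac)
    qed (simp_all add: add1 scaleR_scaleC sc1)
    from riesz_real[OF this] obtain v where v: "\<And>a. Re (B a b) = inner v a" by auto
    have re: "Re (cinner a v) = Re (B a b)" for a by (simp add: Re_cinner v inner_commute)
    have "cinner a v = B a b" for a
      using re[of a] re[of "\<i> *\<^sub>C a"] by (intro complex_eqI) (auto simp: cinner_scaleC_left sc1)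
    then show ?thesis by blast
  qed
  then obtain T where T: "\<And>b a. cinner a (T b) = B a b" by metis
  have "bounded_clinear T"
  proof (rule bounded_clinearI)
    show "T (x + y) = T x + T y" for x y
      by (rule cinner_ext) (simp add: T cinner_add_right add2)
    show "T (c *\<^sub>C x) = c *\<^sub>C T x" for c x
      by (rule cinner_ext) (simp add: T cinner_scaleC_right sc2)
    fix x
    have "(norm (T x))\<^sup>2 = cmod (cinner (T x) (T x))"
      unfolding cinner_self norm_of_real by simp
    also have "\<dots> \<le> K * norm (T x) * norm x" using bd by (simp add: T)
    finally have *: "norm (T x) * norm (T x) \<le> norm (T x) * (K * norm x)"
      by (simp add: power2_eq_square mult_ac)
    show "norm (T x) \<le> K * norm x"
      using * \<open>K \<ge> 0\<close> by (cases "T x = 0") auto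
  qed
  then show ?thesis using T by blast
qed

lemma adjoint_exists:
  assumes "bounded_clinear x"
  shows "\<exists>y. bounded_clinear y \<and> is_adjoint y x"
proof -
  obtain K where K: "K \<ge> 0" "\<And>u. norm (x u) \<le> K * norm u"
    using bounded_clinear_bound[OF assms] by blast
  have "\<exists>T. bounded_clinear T \<and> (\<forall>a b. cinner a (T b) = cinner (x a) b)"
  proof (rule riesz_sesquilinear)
    show "K \<ge> 0" by (fact K)
    show "cmod (cinner (x a) b) \<le> K * norm a * norm b" for a b
      using norm_cinner_le[of "x a" b] mult_right_mono[OF K(2)[of a] norm_ge_zero[of b]] by simp
  qed (simp_all add: assms bounded_clinear_add bounded_clinear_scaleC cinner_add_left
      cinner_scaleC_left cinner_add_right cinner_scaleC_right)
  then obtain T where T: "bounded_clinear T" "\<And>a b. cinner a (T b) = cinner (x a) b" by blast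
  then have "is_adjoint T x"
    unfolding is_adjoint_def by (metis cinner_commute)
  with T show ?thesis by blast
qed

lemma is_adjoint_unique: "is_adjoint y x \<Longrightarrow> is_adjoint y' x \<Longrightarrow> y = y'"
proof (rule ext, rule cinner_ext)
  fix u a assume "is_adjoint y x" "is_adjoint y' x"
  then show "cinner a (y u) = cinner a (y' u)"
    by (metis is_adjoint_def cinner_commute)
qed

abbreviation operators :: "('a::chilbert_space \<Rightarrow> 'a) set" where
  "operators \<equiv> Collect bounded_clinear"

definition op_adjoint :: "('a::chilbert_space \<Rightarrow> 'a) \<Rightarrow> 'a \<Rightarrow> 'a" where
  "op_adjoint x = (THE y. is_adjoint y x)"

lemma op_adjoint_eqI: "is_adjoint y x \<Longrightarrow> op_adjoint x = y"
  unfolding op_adjoint_def by (rule the_equality) (auto intro: is_adjoint_unique)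

lemma op_adjoint_props:
  assumes "bounded_clinear x"
  shows bounded_clinear_op_adjoint: "bounded_clinear (op_adjoint x)"
    and is_adjoint_op_adjoint: "is_adjoint (op_adjoint x) x"
  using adjoint_exists[OF assms] op_adjoint_eqI by auto

lemma op_adjoint_lincomb:
  assumes "bounded_clinear x" "bounded_clinear y"
  shows "op_adjoint (op_lincomb a x b y) = op_lincomb (cnj a) (op_adjoint x) (cnj b) (op_adjoint y)"
  using is_adjoint_op_adjoint[OF assms(1)] is_adjoint_op_adjoint[OF assms(2)]
  by (intro op_adjoint_eqI)
    (simp add: is_adjoint_def op_lincomb_def cinner_add_left cinner_add_right
      cinner_scaleC_left cinner_scaleC_right)

lemma subspace_closure:
  fixes S :: "'v::real_normed_vector set"
  assumes "subspace S"
  shows "subspace (closure S)"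
  unfolding subspace_def
proof (intro conjI ballI allI)
  show "0 \<in> closure S" using subspace_0[OF assms] closure_subset by blast
next
  fix x y assume "x \<in> closure S" "y \<in> closure S"
  then obtain X Y where X: "\<And>n. X n \<in> S" "X \<longlonglongrightarrow> x" and Y: "\<And>n. Y n \<in> S" "Y \<longlonglongrightarrow> y"
    unfolding closure_sequential by blast
  then have "\<And>n. X n + Y n \<in> S" using subspace_add[OF assms] by blast
  then show "x + y \<in> closure S"
    unfolding closure_sequential using tendsto_add[OF X(2) Y(2)] by (intro exI[of _ "\<lambda>n. X n + Y n"]) simp
next
  fix c :: real and x assume "x \<in> closure S"
  then obtain X where X: "\<And>n. X n \<in> S" "X \<longlonglongrightarrow> x" unfolding closure_sequential by blast
  then have "\<And>n. c *\<^sub>R X n \<in> S" using subspace_scale[OF assms] by blast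
  then show "c *\<^sub>R x \<in> closure S"
    unfolding closure_sequential using tendsto_scaleR[OF tendsto_const X(2)] by (intro exI[of _ "\<lambda>n. c *\<^sub>R X n"]) simp
qed

text \<open>
  Extension by continuity of an operator given by its graph \<open>S\<close> on a total set: the norm bound says that
  the closure of \<open>span S\<close> is still the graph of a function, and density and completeness that this
  function is defined everywhere. In particular, well-definedness on \<open>span S\<close> comes for free.
\<close>
lemma bounded_clinear_extension:
  fixes S :: "('a::chilbert_space \<times> 'b::chilbert_space) set"
  assumes scale: "\<And>c u v. (u, v) \<in> S \<Longrightarrow> (c *\<^sub>C u, c *\<^sub>C v) \<in> S"
    and bound: "\<And>u v. (u, v) \<in> span S \<Longrightarrow> norm v \<le> K * norm u"
    and dense: "closure (fst ` span S) = UNIV"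
  shows "\<exists>T. bounded_clinear T \<and> (\<forall>u v. (u, v) \<in> S \<longrightarrow> T u = v)"
proof -
  define G where "G = closure (span S)"
  have sub: "subspace G" unfolding G_def by (simp add: subspace_closure)
  have SG: "S \<subseteq> G"
    unfolding G_def by (rule order_trans[OF span_superset closure_subset])
  have "closed {w :: 'a \<times> 'b. norm (snd w) \<le> K * norm (fst w)}"
    by (intro closed_Collect_le continuous_intros)
  then have "G \<subseteq> {w. norm (snd w) \<le> K * norm (fst w)}"
    unfolding G_def by (rule closure_minimal[rotated]) (use bound in auto)
  then have boundG: "norm v \<le> K * norm u" if "(u, v) \<in> G" for u v using that by auto
  have "\<exists>v. (u, v) \<in> G" for u
  proof -
    have "u \<in> closure (fst ` span S)" using dense by simp
    then obtain U where U: "\<And>n. U n \<in> fst ` span S" "U \<longlonglongrightarrow> u"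
      unfolding closure_sequential by auto
    have "\<exists>v. (U n, v) \<in> span S" for n
    proof -
      obtain w where "w \<in> span S" "U n = fst w" using U(1)[of n] by blast
      then show ?thesis by (intro exI[of _ "snd w"]) simp
    qed
    then obtain V where V: "\<And>n. (U n, V n) \<in> span S" by metis
    have diff: "norm (V m - V n) \<le> K * norm (U m - U n)" for m n
      using bound[of "U m - U n" "V m - V n"] span_diff[OF V[of m] V[of n]] by simp
    have "Cauchy V"
    proof (rule CauchyI)
      fix e :: real assume e: "e > 0"
      define d where "d = e / (\<bar>K\<bar> + 1)"
      have "d > 0" using e by (simp add: d_def)
      then obtain M where M: "\<forall>m\<ge>M. \<forall>n\<ge>M. norm (U m - U n) < d"
        using CauchyD[OF LIMSEQ_imp_Cauchy[OF U(2)]] by blast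
      have "norm (V m - V n) < e" if "m \<ge> M" "n \<ge> M" for m n
      proof -
        have "norm (V m - V n) \<le> (\<bar>K\<bar> + 1) * norm (U m - U n)"
          by (rule order_trans[OF diff mult_right_mono]) auto
        also have "\<dots> < (\<bar>K\<bar> + 1) * d"
          using M that by (intro mult_strict_left_mono) auto
        finally show ?thesis by (simp add: d_def add_nonneg_eq_0_iff)
      qed
      then show "\<exists>M. \<forall>m\<ge>M. \<forall>n\<ge>M. norm (V m - V n) < e" by blast
    qed
    then obtain v where "V \<longlonglongrightarrow> v" using Cauchy_convergent convergent_def by blast
    with U(2) have "(\<lambda>n. (U n, V n)) \<longlonglongrightarrow> (u, v)" by (rule tendsto_Pair)
    then have "(u, v) \<in> G"
      unfolding G_def closure_sequential using V by (intro exI[of _ "\<lambda>n. (U n, V n)"]) simp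
    then show ?thesis by blast
  qed
  then obtain T where T: "\<And>u. (u, T u) \<in> G" by metis
  have unique: "T u = v" if "(u, v) \<in> G" for u v
    using boundG[of 0 "T u - v"] subspace_diff[OF sub T[of u] that] by simp
  have scaleG: "(c *\<^sub>C u, c *\<^sub>C v) \<in> G" if "(u, v) \<in> G" for c u v
  proof -
    define H where "H = (\<lambda>w :: 'a \<times> 'b. (c *\<^sub>C fst w, c *\<^sub>C snd w)) -` G"
    have lin: "bounded_linear (\<lambda>w :: 'a \<times> 'b. (c *\<^sub>C fst w, c *\<^sub>C snd w))"
      by (intro bounded_linear_Pair bounded_linear_compose[OF bounded_linear_scaleC]
          bounded_linear_fst bounded_linear_snd)
    have "closed H"
      unfolding H_def G_def
      by (intro closed_vimage linear_continuous_on[OF lin] closed_closure) 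
    moreover have "subspace H"
      unfolding H_def by (rule linear_subspace_vimage[OF bounded_linear.linear[OF lin] sub])
    moreover have "S \<subseteq> H"
    proof
      fix w assume "w \<in> S"
      then have "(c *\<^sub>C fst w, c *\<^sub>C snd w) \<in> S" using scale[of "fst w" "snd w" c] by simp
      then show "w \<in> H" unfolding H_def using SG by auto
    qed
    ultimately have "G \<subseteq> H" unfolding G_def by (intro closure_minimal span_minimal)
    then show ?thesis using that by (auto simp: H_def)
  qed
  have "bounded_clinear T"
  proof (rule bounded_clinearI)
    show "T (x + y) = T x + T y" for x y
      using unique subspace_add[OF sub T[of x] T[of y]] by simp
    show "T (c *\<^sub>C x) = c *\<^sub>C T x" for c x
      using unique scaleG[OF T] by simp
    show "norm (T x) \<le> K * norm x" for x using boundG[OF T] .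
  qed
  moreover have "\<forall>u v. (u, v) \<in> S \<longrightarrow> T u = v" using unique SG by blast
  ultimately show ?thesis by blast
qed

text \<open>
  Gram--Schmidt without normalisation: a vector that depends linearly on the previous ones adds the
  zero vector to \<open>E\<close>.
\<close>
lemma orthogonalise:
  fixes B :: "'b::chilbert_space set"
  assumes "finite B"
  shows "\<exists>E c. finite E \<and> (\<forall>e\<in>E. \<forall>e'\<in>E. e \<noteq> e' \<longrightarrow> cinner e e' = 0) \<and>
    (\<forall>b\<in>B. b = (\<Sum>e\<in>E. c b e *\<^sub>C e))"
  using assms
proof induction
  case empty
  show ?case by (intro exI[of _ "{}"]) simp
next
  case (insert b B)
  from insert.IH obtain E c where E: "finite E" "\<forall>e\<in>E. \<forall>e'\<in>E. e \<noteq> e' \<longrightarrow> cinner e e' = 0"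
    "\<forall>b\<in>B. b = (\<Sum>e\<in>E. c b e *\<^sub>C e)" by auto
  \<comment> \<open>For \<open>e = 0\<close> the quotient is zero by convention, which is the right coefficient.\<close>
  define k where "k = (\<lambda>e. cinner e b / cinner e e)"
  define d where "d = b - (\<Sum>e\<in>E. k e *\<^sub>C e)"
  have ortho: "cinner e d = 0" if "e \<in> E" for e
  proof -
    have "cinner e (\<Sum>e'\<in>E. k e' *\<^sub>C e') = (\<Sum>e'\<in>E. k e' * cinner e e')"
      by (simp add: cinner_sum_right cinner_scaleC_right)
    also have "\<dots> = (\<Sum>e'\<in>{e}. k e' * cinner e e')"
      by (rule sum.mono_neutral_right) (use E that in auto)
    also have "\<dots> = cinner e b"
      by (cases "e = 0") (auto simp: k_def cinner_self)
    finally show ?thesis by (simp add: d_def cinner_diff_right)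
  qed
  then have ortho': "cinner d e = 0" if "e \<in> E" for e
    using that by (metis cinner_commute complex_cnj_zero)
  define c' where "c' = (\<lambda>b' e. if b' = b then (if e \<in> E then k e else 0) + (if e = d then 1 else 0)
      else if e \<in> E then c b' e else 0)"
  have "b' = (\<Sum>e\<in>insert d E. c' b' e *\<^sub>C e)" if "b' \<in> insert b B" for b'
  proof (cases "b' = b")
    case True
    have "(\<Sum>e\<in>insert d E. c' b e *\<^sub>C e) = (\<Sum>e\<in>insert d E. (if e \<in> E then k e else 0) *\<^sub>C e) +
        (\<Sum>e\<in>insert d E. (if e = d then 1 else 0) *\<^sub>C e)"
      by (simp add: c'_def scaleC_add_left sum.distrib)
    also have "(\<Sum>e\<in>insert d E. (if e \<in> E then k e else 0) *\<^sub>C e) = (\<Sum>e\<in>E. k e *\<^sub>C e)"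
      by (rule sum.mono_neutral_cong_right) (use E(1) in auto)
    also have "(\<Sum>e\<in>insert d E. (if e = d then 1 else 0) *\<^sub>C e) = (\<Sum>e\<in>{d}. e)"
      by (rule sum.mono_neutral_cong_right) (use E(1) in auto)
    finally show ?thesis using True by (simp add: d_def)
  next
    case False
    have "(\<Sum>e\<in>insert d E. c' b' e *\<^sub>C e) = (\<Sum>e\<in>E. c b' e *\<^sub>C e)"
      by (rule sum.mono_neutral_cong_right) (use E(1) False in \<open>auto simp: c'_def\<close>)
    then show ?thesis using E(3) that False by auto
  qed
  moreover have "\<forall>e\<in>insert d E. \<forall>e'\<in>insert d E. e \<noteq> e' \<longrightarrow> cinner e e' = 0"
    using E(2) ortho ortho' by auto
  ultimately show ?case
    using E(1) by (intro exI[of _ "insert d E"] exI[of _ c']) blast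
qed

section \<open>Normal functionals\<close>

text \<open>
  The ultraweakly continuous functionals on all operators, with a bound on the square sums of a
  representing pair of sequences; such an \<open>r\<close> bounds the norm of \<open>f\<close> in the predual. Keeping track of it is
  what allows normal functionals to be summed over an infinite index set. Only the values of \<open>f\<close> at
  bounded operators are constrained, so that \<open>f\<close> may be composed with maps that are only controlled there.
\<close>
definition predual_norm_le :: "(('a::chilbert_space \<Rightarrow> 'a) \<Rightarrow> complex) \<Rightarrow> real \<Rightarrow> bool" where
  "predual_norm_le f r \<longleftrightarrow>
     (\<exists>\<xi> \<eta>. summable (\<lambda>n. (norm (\<xi> n))\<^sup>2) \<and> summable (\<lambda>n. (norm (\<eta> n))\<^sup>2) \<and>
        (\<Sum>n. (norm (\<xi> n))\<^sup>2) \<le> r \<and> (\<Sum>n. (norm (\<eta> n))\<^sup>2) \<le> r \<and>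
        (\<forall>x. bounded_clinear x \<longrightarrow> f x = (\<Sum>n. cinner (\<xi> n) (x (\<eta> n :: 'a)))))"

lemma predual_norm_leI:
  assumes "summable (\<lambda>n. (norm (\<xi> n))\<^sup>2)" "summable (\<lambda>n. (norm (\<eta> n))\<^sup>2)"
    and "(\<Sum>n. (norm (\<xi> n))\<^sup>2) \<le> r" "(\<Sum>n. (norm (\<eta> n))\<^sup>2) \<le> r"
    and "\<And>x. bounded_clinear x \<Longrightarrow> f x = (\<Sum>n. cinner (\<xi> n) (x (\<eta> n)))"
  shows "predual_norm_le f r"
  unfolding predual_norm_le_def using assms by (intro exI[of _ \<xi>] exI[of _ \<eta>]) simp

lemma predual_norm_leE:
  assumes "predual_norm_le f r"
  obtains \<xi> \<eta> where "summable (\<lambda>n. (norm (\<xi> n))\<^sup>2)" "summable (\<lambda>n. (norm (\<eta> n))\<^sup>2)"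
    and "(\<Sum>n. (norm (\<xi> n))\<^sup>2) \<le> r" "(\<Sum>n. (norm (\<eta> n))\<^sup>2) \<le> r"
    and "\<forall>x. bounded_clinear x \<longrightarrow> f x = (\<Sum>n. cinner (\<xi> n) (x (\<eta> n)))"
  using assms unfolding predual_norm_le_def by (elim exE conjE)

lemma summable_coefficients:
  fixes \<xi> \<eta> :: "nat \<Rightarrow> 'a::chilbert_space"
  assumes "summable (\<lambda>n. (norm (\<xi> n))\<^sup>2)" "summable (\<lambda>n. (norm (\<eta> n))\<^sup>2)" "bounded_clinear x"
  shows "summable (\<lambda>n. cmod (cinner (\<xi> n) (x (\<eta> n))))"
proof -
  obtain K where K: "K \<ge> 0" "\<And>u. norm (x u) \<le> K * norm u"
    using bounded_clinear_bound[OF assms(3)] by blast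
  have "cmod (cinner (\<xi> n) (x (\<eta> n))) \<le> K * ((norm (\<xi> n))\<^sup>2 + (norm (\<eta> n))\<^sup>2)" for n
  proof -
    have "cmod (cinner (\<xi> n) (x (\<eta> n))) \<le> norm (\<xi> n) * (K * norm (\<eta> n))"
      using norm_cinner_le[of "\<xi> n" "x (\<eta> n)"] mult_left_mono[OF K(2)[of "\<eta> n"] norm_ge_zero[of "\<xi> n"]]
      by linarith
    also have "\<dots> = K * (norm (\<xi> n) * norm (\<eta> n))" by simp
    also have "\<dots> \<le> K * ((norm (\<xi> n))\<^sup>2 + (norm (\<eta> n))\<^sup>2)"
    proof (rule mult_left_mono[OF _ K(1)])
      have "2 * (norm (\<xi> n) * norm (\<eta> n)) \<le> (norm (\<xi> n))\<^sup>2 + (norm (\<eta> n))\<^sup>2"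
        using sum_squares_bound[of "norm (\<xi> n)" "norm (\<eta> n)"] by simp
      then show "norm (\<xi> n) * norm (\<eta> n) \<le> (norm (\<xi> n))\<^sup>2 + (norm (\<eta> n))\<^sup>2"
        using mult_nonneg_nonneg[OF norm_ge_zero[of "\<xi> n"] norm_ge_zero[of "\<eta> n"]] by linarith
    qed
    finally show ?thesis .
  qed
  then show ?thesis
    by (intro summable_comparison_test'[OF summable_mult[OF summable_add[OF assms(1,2)], of K], of 0])
      auto
qed

lemma predual_norm_le_exists:
  assumes "summable (\<lambda>n. (norm (\<xi> n))\<^sup>2)" "summable (\<lambda>n. (norm (\<eta> n))\<^sup>2)"
    and "\<And>x. bounded_clinear x \<Longrightarrow> f x = (\<Sum>n. cinner (\<xi> n) (x (\<eta> n)))"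
  shows "\<exists>r. predual_norm_le f r"
proof -
  have "predual_norm_le f (max (\<Sum>n. (norm (\<xi> n))\<^sup>2) (\<Sum>n. (norm (\<eta> n))\<^sup>2))"
    by (rule predual_norm_leI[OF assms(1,2)]) (simp_all add: assms(3))
  then show ?thesis by blast
qed

lemma predual_norm_le_mono: "predual_norm_le f r \<Longrightarrow> r \<le> s \<Longrightarrow> predual_norm_le f s"
  by (elim predual_norm_leE, rule predual_norm_leI) auto

lemma predual_norm_le_cong:
  "predual_norm_le f r \<Longrightarrow> (\<And>x. bounded_clinear x \<Longrightarrow> g x = f x) \<Longrightarrow> predual_norm_le g r"
  by (elim predual_norm_leE, rule predual_norm_leI) auto

lemma ultraweak_functional_imp_predual:
  assumes "ultraweak_functional f" shows "\<exists>r. predual_norm_le f r"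
proof -
  obtain \<xi> \<eta> where *: "summable (\<lambda>n. (norm (\<xi> n))\<^sup>2)" "summable (\<lambda>n. (norm (\<eta> n))\<^sup>2)"
    "f = (\<lambda>x. \<Sum>n. cinner (\<xi> n) (x (\<eta> n)))"
    using assms unfolding ultraweak_functional_def by blast
  have "predual_norm_le f (max (\<Sum>n. (norm (\<xi> n))\<^sup>2) (\<Sum>n. (norm (\<eta> n))\<^sup>2))"
    by (rule predual_norm_leI[OF *(1,2)]) (simp_all add: *(3))
  then show ?thesis by blast
qed

lemma predual_imp_ultraweak_functional:
  assumes "predual_norm_le f r"
  shows "\<exists>g. ultraweak_functional g \<and> (\<forall>x. bounded_clinear x \<longrightarrow> f x = g x)"
proof -
  from assms obtain \<xi> \<eta> where "summable (\<lambda>n. (norm (\<xi> n))\<^sup>2)" "summable (\<lambda>n. (norm (\<eta> n))\<^sup>2)"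
    and "(\<Sum>n. (norm (\<xi> n))\<^sup>2) \<le> r" "(\<Sum>n. (norm (\<eta> n))\<^sup>2) \<le> r"
    and f: "\<forall>x. bounded_clinear x \<longrightarrow> f x = (\<Sum>n. cinner (\<xi> n) (x (\<eta> n)))"
    by (rule predual_norm_leE)
  then have "ultraweak_functional (\<lambda>x. \<Sum>n. cinner (\<xi> n) (x (\<eta> n)))"
    unfolding ultraweak_functional_def by (intro exI[of _ \<xi>] exI[of _ \<eta>]) simp
  with f show ?thesis by (intro exI[of _ "\<lambda>x. \<Sum>n. cinner (\<xi> n) (x (\<eta> n))"]) simp
qed

lemma predual_norm_le_coefficient:
  assumes "(norm \<xi>)\<^sup>2 \<le> r" "(norm \<eta>)\<^sup>2 \<le> r"
  shows "predual_norm_le (\<lambda>x. cinner \<xi> (x \<eta>)) r"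
proof -
  define X where "X = (\<lambda>n::nat. if n = 0 then \<xi> else 0)"
  define Y where "Y = (\<lambda>n::nat. if n = 0 then \<eta> else 0)"
  have X: "(\<lambda>n. (norm (X n))\<^sup>2) sums (norm \<xi>)\<^sup>2"
    using sums_finite[of "{0}" "\<lambda>n. (norm (X n))\<^sup>2"] by (simp add: X_def)
  have Y: "(\<lambda>n. (norm (Y n))\<^sup>2) sums (norm \<eta>)\<^sup>2"
    using sums_finite[of "{0}" "\<lambda>n. (norm (Y n))\<^sup>2"] by (simp add: Y_def)
  have "(\<lambda>n. cinner (X n) (x (Y n))) sums cinner \<xi> (x \<eta>)" for x
    using sums_finite[of "{0}" "\<lambda>n. cinner (X n) (x (Y n))"] by (simp add: X_def Y_def)
  then have eq: "cinner \<xi> (x \<eta>) = (\<Sum>n. cinner (X n) (x (Y n)))" for x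
    by (rule sums_unique)
  show ?thesis
  proof (rule predual_norm_leI[of X Y, OF _ _ _ _ eq])
    show "summable (\<lambda>n. (norm (X n))\<^sup>2)" "summable (\<lambda>n. (norm (Y n))\<^sup>2)"
      using X Y by (blast intro: sums_summable)+
    show "(\<Sum>n. (norm (X n))\<^sup>2) \<le> r" "(\<Sum>n. (norm (Y n))\<^sup>2) \<le> r"
      using sums_unique[OF X] sums_unique[OF Y] assms by simp_all
  qed
qed

text \<open>
  Square summable families indexed by pairs of numbers are rearranged into sequences by the pairing
  function; absolute convergence makes the iterated sum agree with the rearranged one.
\<close>
lemma predual_norm_le_sums:
  fixes F :: "nat \<Rightarrow> ('a::chilbert_space \<Rightarrow> 'a) \<Rightarrow> complex"
  assumes F: "\<And>m. predual_norm_le (F m) (r m)" and r: "summable r"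
    and G: "\<And>x. bounded_clinear x \<Longrightarrow> (\<lambda>m. F m x) sums G x"
  shows "predual_norm_le G (\<Sum>m. r m)"
proof -
  have "\<exists>p. summable (\<lambda>n. (norm (fst p n))\<^sup>2) \<and> summable (\<lambda>n. (norm (snd p n))\<^sup>2) \<and>
      (\<Sum>n. (norm (fst p n))\<^sup>2) \<le> r m \<and> (\<Sum>n. (norm (snd p n))\<^sup>2) \<le> r m \<and>
      (\<forall>x. bounded_clinear x \<longrightarrow> F m x = (\<Sum>n. cinner (fst p n) (x (snd p n))))" for m
  proof -
    obtain \<xi> \<eta> where *: "summable (\<lambda>n. (norm (\<xi> n))\<^sup>2)" "summable (\<lambda>n. (norm (\<eta> n))\<^sup>2)"
      and "(\<Sum>n. (norm (\<xi> n))\<^sup>2) \<le> r m" "(\<Sum>n. (norm (\<eta> n))\<^sup>2) \<le> r m"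
      and "\<forall>x. bounded_clinear x \<longrightarrow> F m x = (\<Sum>n. cinner (\<xi> n) (x (\<eta> n)))"
      using F[of m] by (rule predual_norm_leE)
    then show ?thesis by (intro exI[of _ "(\<xi>, \<eta>)"]) simp
  qed
  from choice[OF allI[OF this]] obtain p where p:
    "\<forall>m. summable (\<lambda>n. (norm (fst (p m) n))\<^sup>2) \<and> summable (\<lambda>n. (norm (snd (p m) n))\<^sup>2) \<and>
      (\<Sum>n. (norm (fst (p m) n))\<^sup>2) \<le> r m \<and> (\<Sum>n. (norm (snd (p m) n))\<^sup>2) \<le> r m \<and>
      (\<forall>x. bounded_clinear x \<longrightarrow> F m x = (\<Sum>n. cinner (fst (p m) n) (x (snd (p m) n))))"
    by (rule exE)
  define \<xi> where "\<xi> = (\<lambda>m. fst (p m))"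
  define \<eta> where "\<eta> = (\<lambda>m. snd (p m))"
  have s1: "summable (\<lambda>n. (norm (\<xi> m n))\<^sup>2)" and s2: "summable (\<lambda>n. (norm (\<eta> m n))\<^sup>2)"
    and b1: "(\<Sum>n. (norm (\<xi> m n))\<^sup>2) \<le> r m" and b2: "(\<Sum>n. (norm (\<eta> m n))\<^sup>2) \<le> r m"
    and eq: "bounded_clinear x \<Longrightarrow> F m x = (\<Sum>n. cinner (\<xi> m n) (x (\<eta> m n)))" for m x
    using p by (simp_all add: \<xi>_def \<eta>_def)
  define X where "X = (\<lambda>k. case prod_decode k of (m, n) \<Rightarrow> \<xi> m n)"
  define Y where "Y = (\<lambda>k. case prod_decode k of (m, n) \<Rightarrow> \<eta> m n)"
  have bij: "bij_betw prod_decode UNIV (UNIV \<times> UNIV)"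
    using bij_prod_decode by simp
  have square: "summable (\<lambda>k. case prod_decode k of (m, n) \<Rightarrow> (norm (Z m n))\<^sup>2) \<and>
      (\<Sum>k. case prod_decode k of (m, n) \<Rightarrow> (norm (Z m n))\<^sup>2) \<le> (\<Sum>m. r m)"
    if s: "\<And>m. summable (\<lambda>n. (norm (Z m n))\<^sup>2)" and b: "\<And>m. (\<Sum>n. (norm (Z m n))\<^sup>2) \<le> r m"
    for Z :: "nat \<Rightarrow> nat \<Rightarrow> 'a"
  proof -
    define q where "q = (\<lambda>m. \<Sum>n. (norm (Z m n))\<^sup>2)"
    have q0: "0 \<le> q m" for m unfolding q_def by (rule suminf_nonneg[OF s]) simp
    have q: "summable q" by (rule summable_comparison_test'[OF r, of 0]) (use q0 b in \<open>auto simp: q_def\<close>)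
    have inner: "((\<lambda>n. (norm (Z m n))\<^sup>2) has_sum q m) UNIV" for m
      unfolding q_def by (rule sums_nonneg_imp_has_sum) (use s in \<open>auto intro: summable_sums\<close>)
    have outer: "(q has_sum suminf q) UNIV"
      by (rule sums_nonneg_imp_has_sum) (use q q0 in \<open>auto intro: summable_sums\<close>)
    have "((\<lambda>(m, n). (norm (Z m n))\<^sup>2) has_sum suminf q) (UNIV \<times> UNIV)"
      by (rule has_sum_SigmaI[OF _ outer summable_on_SigmaI[OF _ has_sum_imp_summable[OF outer]]])
        (use inner in auto)
    then have "((\<lambda>k. (\<lambda>(m, n). (norm (Z m n))\<^sup>2) (prod_decode k)) has_sum suminf q) UNIV"
      using has_sum_reindex_bij_betw[OF bij] by blast
    then have "(\<lambda>k. case prod_decode k of (m, n) \<Rightarrow> (norm (Z m n))\<^sup>2) sums suminf q"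
      by (rule has_sum_imp_sums)
    moreover have "suminf q \<le> suminf r" by (rule suminf_le[OF _ q r]) (use b in \<open>auto simp: q_def\<close>)
    ultimately show ?thesis by (auto simp: sums_iff)
  qed
  have X: "summable (\<lambda>k. (norm (X k))\<^sup>2)" "(\<Sum>k. (norm (X k))\<^sup>2) \<le> (\<Sum>m. r m)"
    and Y: "summable (\<lambda>k. (norm (Y k))\<^sup>2)" "(\<Sum>k. (norm (Y k))\<^sup>2) \<le> (\<Sum>m. r m)"
    using square[OF s1 b1] square[OF s2 b2] by (simp_all add: X_def Y_def case_prod_unfold)
  have "G x = (\<Sum>k. cinner (X k) (x (Y k)))" if x: "bounded_clinear x" for x
  proof -
    have abs: "summable (\<lambda>k. norm (cinner (X k) (x (Y k))))"
      by (rule summable_coefficients[OF X(1) Y(1) x])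
    have "((\<lambda>k. cinner (X k) (x (Y k))) has_sum (\<Sum>k. cinner (X k) (x (Y k)))) UNIV"
      by (rule norm_summable_imp_has_sum[OF abs summable_sums[OF summable_norm_cancel[OF abs]]])
    then have "((\<lambda>k. (\<lambda>(m, n). cinner (\<xi> m n) (x (\<eta> m n))) (prod_decode k)) has_sum
        (\<Sum>k. cinner (X k) (x (Y k)))) UNIV"
      by (simp add: X_def Y_def case_prod_unfold)
    then have total: "((\<lambda>(m, n). cinner (\<xi> m n) (x (\<eta> m n))) has_sum
        (\<Sum>k. cinner (X k) (x (Y k)))) (UNIV \<times> UNIV)"
      using has_sum_reindex_bij_betw[OF bij] by blast
    have "((\<lambda>n. cinner (\<xi> m n) (x (\<eta> m n))) has_sum F m x) UNIV" for m
    proof -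
      have abs: "summable (\<lambda>n. norm (cinner (\<xi> m n) (x (\<eta> m n))))"
        by (rule summable_coefficients[OF s1 s2 x])
      show ?thesis
        unfolding eq[OF x]
        by (rule norm_summable_imp_has_sum[OF abs summable_sums[OF summable_norm_cancel[OF abs]]])
    qed
    then have "((\<lambda>m. F m x) has_sum (\<Sum>k. cinner (X k) (x (Y k)))) UNIV"
      by (intro has_sum_SigmaD[OF total]) auto
    then have "(\<lambda>m. F m x) sums (\<Sum>k. cinner (X k) (x (Y k)))"
      by (rule has_sum_imp_sums)
    with G[OF x] show ?thesis using sums_unique2 by blast
  qed
  then show ?thesis by (rule predual_norm_leI[OF X(1) Y(1) X(2) Y(2)])
qed

lemma predual_norm_le_zero: "predual_norm_le (\<lambda>_. 0) 0"
  using predual_norm_le_coefficient[of 0 0 0] by simp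

lemma predual_norm_le_add:
  assumes "predual_norm_le f r" "predual_norm_le g s"
  shows "predual_norm_le (\<lambda>x. f x + g x) (r + s)"
proof -
  define F where "F = (\<lambda>m::nat. if m = 0 then f else if m = 1 then g else (\<lambda>_. 0))"
  define q where "q = (\<lambda>m::nat. if m = 0 then r else if m = 1 then s else 0)"
  have F: "(\<lambda>m. F m x) sums (f x + g x)" for x
    using sums_finite[of "{0, 1}" "\<lambda>m. F m x"] by (auto simp: F_def)
  have q: "q sums (r + s)"
    using sums_finite[of "{0, 1}" q] by (auto simp: q_def)
  have "predual_norm_le (\<lambda>x. f x + g x) (\<Sum>m. q m)"
  proof (rule predual_norm_le_sums)
    show "predual_norm_le (F m) (q m)" for m
      using assms predual_norm_le_zero by (auto simp: F_def q_def)
    show "summable q" using q by (auto simp: sums_iff)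
  qed (rule F)
  then show ?thesis using q by (simp add: sums_iff)
qed

lemma predual_norm_le_finite_sum:
  assumes "finite I" "\<And>i. i \<in> I \<Longrightarrow> predual_norm_le (f i) (r i)"
  shows "predual_norm_le (\<lambda>x. \<Sum>i\<in>I. f i x) (\<Sum>i\<in>I. r i)"
  using assms
proof induction
  case empty
  show ?case using predual_norm_le_zero by simp
next
  case (insert i I)
  then show ?case using predual_norm_le_add[of "f i" "r i"] by simp
qed

lemma predual_norm_le_scale:
  assumes "predual_norm_le f r"
  shows "\<exists>s. predual_norm_le (\<lambda>x. c * f x) s"
proof -
  obtain \<xi> \<eta> where *: "summable (\<lambda>n. (norm (\<xi> n))\<^sup>2)" "summable (\<lambda>n. (norm (\<eta> n))\<^sup>2)"
    and "(\<Sum>n. (norm (\<xi> n))\<^sup>2) \<le> r" "(\<Sum>n. (norm (\<eta> n))\<^sup>2) \<le> r"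
    and f: "\<forall>x. bounded_clinear x \<longrightarrow> f x = (\<Sum>n. cinner (\<xi> n) (x (\<eta> n)))"
    using assms by (rule predual_norm_leE)
  have eq: "c * f x = (\<Sum>n. cinner (\<xi> n) (x (c *\<^sub>C \<eta> n)))" if x: "bounded_clinear x" for x
    using suminf_mult[OF summable_norm_cancel[OF summable_coefficients[OF * x]], of c]
    by (simp add: f[rule_format, OF x] bounded_clinear_scaleC[OF x] cinner_scaleC_right)
  have "summable (\<lambda>n. (norm (c *\<^sub>C \<eta> n))\<^sup>2)"
    using summable_mult[OF *(2), of "(cmod c)\<^sup>2"] by (simp add: norm_scaleC power_mult_distrib)
  with * eq have "ultraweak_functional (\<lambda>x. \<Sum>n. cinner (\<xi> n) (x (c *\<^sub>C \<eta> n)))"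
    unfolding ultraweak_functional_def
    by (intro exI[of _ \<xi>] exI[of _ "\<lambda>n. c *\<^sub>C \<eta> n"]) auto
  then obtain s where "predual_norm_le (\<lambda>x. \<Sum>n. cinner (\<xi> n) (x (c *\<^sub>C \<eta> n))) s"
    using ultraweak_functional_imp_predual by blast
  then show ?thesis using eq by (blast intro: predual_norm_le_cong)
qed

lemma predual_finite_lincomb:
  assumes "finite I" "\<And>i. i \<in> I \<Longrightarrow> \<exists>r. predual_norm_le (f i) r"
  shows "\<exists>r. predual_norm_le (\<lambda>x. \<Sum>i\<in>I. c i * f i x) r"
  using assms
proof (induction I)
  case empty
  then show ?case using predual_norm_le_zero by auto
next
  case (insert i I)
  then obtain r where "predual_norm_le (\<lambda>x. \<Sum>i\<in>I. c i * f i x) r" by auto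
  moreover obtain s where "predual_norm_le (\<lambda>x. c i * f i x) s"
    using insert.prems predual_norm_le_scale by blast
  ultimately show ?case using insert.hyps predual_norm_le_add[of "\<lambda>x. c i * f i x" s]
    by auto
qed

lemma predual_lincomb:
  assumes "predual_norm_le f r" "bounded_clinear x" "bounded_clinear y"
  shows "f (op_lincomb a x b y) = a * f x + b * f y"
proof -
  obtain \<xi> \<eta> where *: "summable (\<lambda>n. (norm (\<xi> n))\<^sup>2)" "summable (\<lambda>n. (norm (\<eta> n))\<^sup>2)"
    and "(\<Sum>n. (norm (\<xi> n))\<^sup>2) \<le> r" "(\<Sum>n. (norm (\<eta> n))\<^sup>2) \<le> r"
    and f: "\<forall>x. bounded_clinear x \<longrightarrow> f x = (\<Sum>n. cinner (\<xi> n) (x (\<eta> n)))"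
    using assms(1) by (rule predual_norm_leE)
  have x: "(\<lambda>n. cinner (\<xi> n) (x (\<eta> n))) sums f x"
    unfolding f[rule_format, OF assms(2)]
    by (rule summable_sums[OF summable_norm_cancel[OF summable_coefficients[OF * assms(2)]]])
  have y: "(\<lambda>n. cinner (\<xi> n) (y (\<eta> n))) sums f y"
    unfolding f[rule_format, OF assms(3)]
    by (rule summable_sums[OF summable_norm_cancel[OF summable_coefficients[OF * assms(3)]]])
  have "(\<lambda>n. cinner (\<xi> n) (op_lincomb a x b y (\<eta> n))) sums (a * f x + b * f y)"
    using sums_add[OF sums_mult[OF x, of a] sums_mult[OF y, of b]]
    by (simp add: op_lincomb_def cinner_add_right cinner_scaleC_right)
  then show ?thesis
    using f[rule_format, OF bounded_clinear_lincomb[OF assms(2,3)]] by (simp add: sums_iff)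
qed

section \<open>The ultraweak topology\<close>

lemma ultraweak_functional_zero: "ultraweak_functional (\<lambda>_. 0)"
  unfolding ultraweak_functional_def
  by (intro exI[of _ "\<lambda>_. 0"]) simp

lemma topspace_ultraweak [simp]: "topspace (ultraweak_topology A) = A"
proof -
  have "{x \<in> A. (\<lambda>_. 0::complex) x \<in> UNIV} \<in>
      {{x \<in> A. f x \<in> V} | f V. ultraweak_functional f \<and> open V}"
    using ultraweak_functional_zero open_UNIV by blast
  then show ?thesis unfolding ultraweak_topology_def by auto
qed

lemma continuous_map_ultraweak_functional:
  assumes "A \<subseteq> Collect bounded_clinear" "predual_norm_le f r"
  shows "continuous_map (ultraweak_topology A) euclidean f"
  unfolding continuous_map
proof (intro conjI allI impI)
  fix V :: "complex set" assume "openin euclidean V"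
  obtain g where g: "ultraweak_functional g" "\<And>x. bounded_clinear x \<Longrightarrow> f x = g x"
    using predual_imp_ultraweak_functional[OF assms(2)] by blast
  have "{x \<in> A. f x \<in> V} = {x \<in> A. g x \<in> V}" using assms(1) g(2) by auto
  moreover have "openin (ultraweak_topology A) {x \<in> A. g x \<in> V}"
    unfolding ultraweak_topology_def using g(1) \<open>openin euclidean V\<close>
    by (intro topology_generated_by_Basis) auto
  ultimately show "openin (ultraweak_topology A) {x \<in> topspace (ultraweak_topology A). f x \<in> V}"
    by simp
qed simp

lemma continuous_map_into_ultraweak:
  assumes "T \<in> topspace X \<rightarrow> B"
    and "\<And>f r. predual_norm_le f r \<Longrightarrow> continuous_map X euclidean (\<lambda>x. f (T x))"
  shows "continuous_map X (ultraweak_topology B) T"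
  unfolding ultraweak_topology_def
proof (rule continuous_on_generated_topo)
  fix U assume "U \<in> {{x \<in> B. f x \<in> V} | f V. ultraweak_functional f \<and> open V}"
  then obtain f V where U: "U = {x \<in> B. f x \<in> V}" "ultraweak_functional f" "open V" by auto
  obtain r where "predual_norm_le f r" using ultraweak_functional_imp_predual U(2) by blast
  from assms(2)[OF this] have "openin X {x \<in> topspace X. f (T x) \<in> V}"
    using U(3) by (simp add: continuous_map)
  also have "{x \<in> topspace X. f (T x) \<in> V} = T -` U \<inter> topspace X"
    using assms(1) U(1) by auto
  finally show "openin X (T -` U \<inter> topspace X)" .
next
  show "T ` topspace X \<subseteq> \<Union> {{x \<in> B. f x \<in> V} | f V. ultraweak_functional f \<and> open V}"
    using assms(1) topspace_ultraweak[of B] unfolding ultraweak_topology_def by auto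
qed

lemma ultraweak_subtopology:
  assumes "A \<subseteq> B"
  shows "ultraweak_topology A = subtopology (ultraweak_topology B) A"
proof (rule topology_eq[THEN iffD2], intro allI iffI)
  fix S assume "openin (ultraweak_topology A) S"
  then have S: "generate_topology_on {{x \<in> A. f x \<in> V} | f V. ultraweak_functional f \<and> open V} S"
    unfolding ultraweak_topology_def by (rule openin_topology_generated_by)
  show "openin (subtopology (ultraweak_topology B) A) S"
  proof (rule generate_topology_on_coarsest[OF istopology_openin _ S])
    fix s assume "s \<in> {{x \<in> A. f x \<in> V} | f V. ultraweak_functional f \<and> open V}"
    then obtain f V where s: "s = {x \<in> A. f x \<in> V}" "ultraweak_functional f" "open V" by auto
    then have "openin (ultraweak_topology B) {x \<in> B. f x \<in> V}"
      unfolding ultraweak_topology_def by (intro topology_generated_by_Basis) auto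
    moreover have "s = {x \<in> B. f x \<in> V} \<inter> A" using s assms by auto
    ultimately show "openin (subtopology (ultraweak_topology B) A) s"
      by (auto simp: openin_subtopology)
  qed
next
  fix S assume "openin (subtopology (ultraweak_topology B) A) S"
  then obtain T where T: "openin (ultraweak_topology B) T" "S = T \<inter> A"
    by (auto simp: openin_subtopology)
  have "continuous_map (ultraweak_topology A) (ultraweak_topology B) (\<lambda>x. x)"
    unfolding ultraweak_topology_def[of B]
  proof (rule continuous_on_generated_topo)
    fix U assume "U \<in> {{x \<in> B. f x \<in> V} | f V. ultraweak_functional f \<and> open V}"
    then obtain f V where U: "U = {x \<in> B. f x \<in> V}" and f: "ultraweak_functional f" "open V" by auto
    have "openin (ultraweak_topology A) {x \<in> A. f x \<in> V}"
      unfolding ultraweak_topology_def using f by (intro topology_generated_by_Basis) blast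
    moreover have "(\<lambda>x. x) -` U \<inter> topspace (ultraweak_topology A) = {x \<in> A. f x \<in> V}"
      using assms U by auto
    ultimately show "openin (ultraweak_topology A) ((\<lambda>x. x) -` U \<inter> topspace (ultraweak_topology A))"
      by simp
  next
    show "(\<lambda>x. x) ` topspace (ultraweak_topology A) \<subseteq>
        \<Union> {{x \<in> B. f x \<in> V} | f V. ultraweak_functional f \<and> open V}"
      using assms topspace_ultraweak[of B] unfolding ultraweak_topology_def[of B] by auto
  qed
  from openin_continuous_map_preimage[OF this T(1)]
  show "openin (ultraweak_topology A) S"
    using T(2) by (simp add: Int_commute Collect_conj_eq)
qed

text \<open>
  The sets allowed on the right form a base of neighbourhoods of \<open>0\<close>, by induction on the generation
  of open sets from the subbase.
\<close>
lemma ultraweak_neighbourhood_zero: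
  assumes "openin (ultraweak_topology A) U" "(\<lambda>_. 0) \<in> U"
  shows "\<exists>F \<epsilon>. finite F \<and> \<epsilon> > 0 \<and> (\<forall>f\<in>F. ultraweak_functional f) \<and>
    (\<forall>x\<in>A. (\<forall>f\<in>F. cmod (f x) < \<epsilon>) \<longrightarrow> x \<in> U)"
proof -
  have "generate_topology_on {{x \<in> A. f x \<in> V} | f V. ultraweak_functional f \<and> open V} U"
    using assms(1) unfolding ultraweak_topology_def by (rule openin_topology_generated_by)
  then show ?thesis
    using assms(2)
  proof (induction)
    case Empty
    then show ?case by simp
  next
    case (Int a b)
    from Int obtain F \<epsilon> where 1: "finite F" "\<epsilon> > 0" "\<forall>f\<in>F. ultraweak_functional f"
      "\<forall>x\<in>A. (\<forall>f\<in>F. cmod (f x) < \<epsilon>) \<longrightarrow> x \<in> a" by auto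
    from Int obtain G \<delta> where 2: "finite G" "\<delta> > 0" "\<forall>f\<in>G. ultraweak_functional f"
      "\<forall>x\<in>A. (\<forall>f\<in>G. cmod (f x) < \<delta>) \<longrightarrow> x \<in> b" by auto
    from 1 2 show ?case
      by (intro exI[of _ "F \<union> G"] exI[of _ "min \<epsilon> \<delta>"]) auto
  next
    case (UN K)
    then obtain k where "k \<in> K" "(\<lambda>_. 0) \<in> k" by auto
    with UN.IH[OF this] show ?case by (meson UnionI)
  next
    case (Basis s)
    then obtain f V where s: "s = {x \<in> A. f x \<in> V}" "ultraweak_functional f" "open V" by auto
    have "f (\<lambda>_. 0) = 0"
      using s(2) by (auto simp: ultraweak_functional_def)
    then have "0 \<in> V" using Basis.prems s(1) by auto
    then obtain \<epsilon> where "\<epsilon> > 0" "ball 0 \<epsilon> \<subseteq> V" using s(3) open_contains_ball by blast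
    then have "\<forall>x\<in>A. cmod (f x) < \<epsilon> \<longrightarrow> x \<in> s" using s(1) by auto
    with s(2) \<open>\<epsilon> > 0\<close> show ?case
      by (intro exI[of _ "{f}"] exI[of _ \<epsilon>]) auto
  qed
qed

text \<open>
  The finite-dimensional heart of the extension theorem. If \<open>g\<close> does not vanish on the common
  kernel of the other functionals \<open>F\<close>, subtracting a multiple of \<open>g\<close> from \<open>\<phi>\<close> makes the difference vanish there.
\<close>
lemma functional_in_span:
  fixes \<phi> :: "('a::chilbert_space \<Rightarrow> 'a) \<Rightarrow> complex"
  assumes "finite F"
    and M: "\<And>x y a b. x \<in> M \<Longrightarrow> y \<in> M \<Longrightarrow> op_lincomb a x b y \<in> M"
    and F: "\<And>f x y a b. f \<in> F \<Longrightarrow> x \<in> M \<Longrightarrow> y \<in> M \<Longrightarrow> f (op_lincomb a x b y) = a * f x + b * f y"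
    and "\<And>x y a b. x \<in> M \<Longrightarrow> y \<in> M \<Longrightarrow> \<phi> (op_lincomb a x b y) = a * \<phi> x + b * \<phi> y"
    and "\<And>x. x \<in> M \<Longrightarrow> (\<forall>f\<in>F. f x = 0) \<Longrightarrow> \<phi> x = 0"
  shows "\<exists>c. \<forall>x\<in>M. \<phi> x = (\<Sum>f\<in>F. c f * f x)"
  using assms(1) F assms(4,5)
proof (induction F arbitrary: \<phi>)
  case empty
  then show ?case by auto
next
  case (insert g F)
  show ?case
  proof (cases "\<forall>x\<in>M. (\<forall>f\<in>F. f x = 0) \<longrightarrow> g x = 0")
    case True
    have "\<exists>c. \<forall>x\<in>M. \<phi> x = (\<Sum>f\<in>F. c f * f x)"
    proof (rule insert.IH)
      show "\<phi> x = 0" if "x \<in> M" "\<forall>f\<in>F. f x = 0" for x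
        using True that by (intro insert.prems(3)) auto
    qed (use insert.prems in auto)
    then obtain c where c: "\<forall>x\<in>M. \<phi> x = (\<Sum>f\<in>F. c f * f x)" by blast
    have "(\<Sum>f\<in>insert g F. (c(g := 0)) f * f x) = (\<Sum>f\<in>F. c f * f x)" for x
      using insert.hyps by (auto intro!: sum.cong)
    with c show ?thesis by (intro exI[of _ "c(g := 0)"]) simp
  next
    case False
    then obtain z where z: "z \<in> M" "\<forall>f\<in>F. f z = 0" "g z \<noteq> 0" by auto
    define k where "k = \<phi> z / g z"
    have "\<exists>c. \<forall>x\<in>M. \<phi> x - k * g x = (\<Sum>f\<in>F. c f * f x)"
    proof (rule insert.IH)
      fix x assume x: "x \<in> M" "\<forall>f\<in>F. f x = 0"
      define w where "w = op_lincomb 1 x (- (g x / g z)) z"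
      have "w \<in> M" using M x z by (simp add: w_def)
      have "f w = 0" if "f \<in> insert g F" for f
        using that insert.prems(1)[OF that x(1) z(1)] x z by (auto simp: w_def)
      then have "\<phi> w = 0" using \<open>w \<in> M\<close> insert.prems(3) by blast
      then show "\<phi> x - k * g x = 0"
        using insert.prems(2)[OF x(1) z(1)] by (simp add: w_def k_def)
    next
      fix x y a b assume "x \<in> M" "y \<in> M"
      then show "\<phi> (op_lincomb a x b y) - k * g (op_lincomb a x b y) =
          a * (\<phi> x - k * g x) + b * (\<phi> y - k * g y)"
        by (simp only: insert.prems(1)[OF insertI1] insert.prems(2)) (simp add: algebra_simps)
    qed (use insert.prems in auto)
    then obtain c where c: "\<forall>x\<in>M. \<phi> x - k * g x = (\<Sum>f\<in>F. c f * f x)" by blast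
    have "(\<Sum>f\<in>insert g F. (c(g := k)) f * f x) = k * g x + (\<Sum>f\<in>F. c f * f x)" for x
      using insert.hyps by (auto intro!: sum.cong)
    moreover have "\<phi> x = k * g x + (\<Sum>f\<in>F. c f * f x)" if "x \<in> M" for x
      using c that by (simp add: algebra_simps)
    ultimately show ?thesis by (intro exI[of _ "c(g := k)"]) simp
  qed
qed

text \<open>
  Continuity bounds \<open>\<phi>\<close> on a neighbourhood of \<open>0\<close> cut out by finitely many normal functionals. Where
  they all vanish, scaling shows that \<open>\<phi>\<close> vanishes as well, so \<open>\<phi>\<close> is one of their linear combinations,
  and these are defined on all operators.
\<close>
lemma uw_linear_functional_extend:
  assumes bd: "M \<subseteq> Collect bounded_clinear" and "M \<noteq> {}"
    and M: "\<And>x y a b. x \<in> M \<Longrightarrow> y \<in> M \<Longrightarrow> op_lincomb a x b y \<in> M"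
    and \<phi>: "uw_linear_functional M \<phi>"
  shows "\<exists>f r. predual_norm_le f r \<and> (\<forall>x\<in>M. \<phi> x = f x)"
proof -
  have lin: "\<phi> (op_lincomb a x b y) = a * \<phi> x + b * \<phi> y" if "x \<in> M" "y \<in> M" for a b x y
    using \<phi> that by (auto simp: uw_linear_functional_def)
  obtain x where x: "x \<in> M" using \<open>M \<noteq> {}\<close> by blast
  have zero: "op_lincomb 0 x 0 x = (\<lambda>_. 0)" by (simp add: op_lincomb_def)
  then have zM: "(\<lambda>_. 0) \<in> M" using M[OF x x, of 0 0] by simp
  have "\<phi> (\<lambda>_. 0) = 0" using lin[OF x x, of 0 0] zero by simp
  define U where "U = {x \<in> M. \<phi> x \<in> ball 0 1}"
  have "openin (ultraweak_topology M) U"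
    using openin_continuous_map_preimage[of "ultraweak_topology M" euclidean \<phi> "ball 0 1"] \<phi>
    unfolding uw_linear_functional_def U_def by simp
  moreover have "(\<lambda>_. 0) \<in> U" using zM \<open>\<phi> (\<lambda>_. 0) = 0\<close> by (simp add: U_def)
  ultimately have "\<exists>F \<epsilon>. finite F \<and> \<epsilon> > 0 \<and> (\<forall>f\<in>F. ultraweak_functional f) \<and>
      (\<forall>x\<in>M. (\<forall>f\<in>F. cmod (f x) < \<epsilon>) \<longrightarrow> x \<in> U)"
    by (rule ultraweak_neighbourhood_zero)
  then obtain F \<epsilon> where F: "finite F" "\<epsilon> > 0" "\<forall>f\<in>F. ultraweak_functional f"
    "\<forall>x\<in>M. (\<forall>f\<in>F. cmod (f x) < \<epsilon>) \<longrightarrow> x \<in> U"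
    by (elim exE conjE)
  have Fp: "\<exists>r. predual_norm_le f r" if "f \<in> F" for f
    using F(3) that ultraweak_functional_imp_predual by blast
  have Flin: "f (op_lincomb a x b y) = a * f x + b * f y" if "f \<in> F" "x \<in> M" "y \<in> M" for f a b x y
    using Fp[OF that(1)] that(2,3) bd predual_lincomb by blast
  have "\<exists>c. \<forall>x\<in>M. \<phi> x = (\<Sum>f\<in>F. c f * f x)"
  proof (rule functional_in_span[OF F(1) M Flin lin])
    fix x assume x: "x \<in> M" "\<forall>f\<in>F. f x = 0"
    show "\<phi> x = 0"
    proof (rule ccontr)
      assume ne: "\<phi> x \<noteq> 0"
      define w where "w = op_lincomb (1 / \<phi> x) x 0 x"
      have "w \<in> M" using M x by (simp add: w_def)
      have "cmod (f w) < \<epsilon>" if "f \<in> F" for f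
      proof -
        have "f w = 0" using Flin[OF that x(1) x(1)] x that by (simp add: w_def)
        then show ?thesis using F(2) by simp
      qed
      then have "w \<in> U" using F(4) \<open>w \<in> M\<close> by blast
      moreover have "\<phi> w = 1" using lin[OF x(1) x(1)] ne by (simp add: w_def)
      ultimately show False by (simp add: U_def)
    qed
  qed auto
  then obtain c where c: "\<forall>x\<in>M. \<phi> x = (\<Sum>f\<in>F. c f * f x)" by blast
  obtain r where "predual_norm_le (\<lambda>x. \<Sum>f\<in>F. c f * f x) r"
    using predual_finite_lincomb[OF F(1), of "\<lambda>f. f" c] Fp by blast
  with c show ?thesis by blast
qed

lemma continuous_map_operators:
  assumes "\<And>x. x \<in> operators \<Longrightarrow> T x \<in> operators"
    and "\<And>f r. predual_norm_le f r \<Longrightarrow> \<exists>s. predual_norm_le (\<lambda>x. f (T x)) s"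
  shows "continuous_map (ultraweak_topology operators) (ultraweak_topology operators) T"
proof (rule continuous_map_into_ultraweak)
  show "T \<in> topspace (ultraweak_topology operators) \<rightarrow> operators"
    using assms(1) by (simp add: Pi_def)
next
  fix f :: "('b \<Rightarrow> 'b) \<Rightarrow> complex" and r assume "predual_norm_le f r"
  from assms(2)[OF this] obtain s where "predual_norm_le (\<lambda>x. f (T x)) s" ..
  then show "continuous_map (ultraweak_topology operators) euclidean (\<lambda>x. f (T x))"
    by (rule continuous_map_ultraweak_functional[OF subset_refl])
qed

lemma summable_norm_bounded_clinear:
  assumes "bounded_clinear y" "summable (\<lambda>n. (norm (\<eta> n))\<^sup>2)"
  shows "summable (\<lambda>n. (norm (y (\<eta> n)))\<^sup>2)"
proof -
  obtain K where K: "K \<ge> 0" "\<And>u. norm (y u) \<le> K * norm u"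
    using bounded_clinear_bound[OF assms(1)] by blast
  have "(norm (y (\<eta> n)))\<^sup>2 \<le> K\<^sup>2 * (norm (\<eta> n))\<^sup>2" for n
    using power_mono[OF K(2)[of "\<eta> n"] norm_ge_zero, of 2] by (simp add: power_mult_distrib)
  then show ?thesis
    by (intro summable_comparison_test'[OF summable_mult[OF assms(2), of "K\<^sup>2"], of 0]) auto
qed

lemma continuous_map_comp_right:
  assumes "bounded_clinear y"
  shows "continuous_map (ultraweak_topology operators) (ultraweak_topology operators) (\<lambda>x. x \<circ> y)"
proof (rule continuous_map_operators)
  show "x \<in> operators \<Longrightarrow> x \<circ> y \<in> operators" for x :: "'a \<Rightarrow> 'a"
    using assms bounded_clinear_comp by blast
next
  fix f :: "('a \<Rightarrow> 'a) \<Rightarrow> complex" and r assume "predual_norm_le f r"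
  then obtain \<xi> \<eta> where s: "summable (\<lambda>n. (norm (\<xi> n))\<^sup>2)" "summable (\<lambda>n. (norm (\<eta> n))\<^sup>2)"
    and "(\<Sum>n. (norm (\<xi> n))\<^sup>2) \<le> r" "(\<Sum>n. (norm (\<eta> n))\<^sup>2) \<le> r"
    and f: "\<forall>x. bounded_clinear x \<longrightarrow> f x = (\<Sum>n. cinner (\<xi> n) (x (\<eta> n)))"
    by (rule predual_norm_leE)
  show "\<exists>s. predual_norm_le (\<lambda>x. f (x \<circ> y)) s"
  proof (rule predual_norm_le_exists[OF s(1) summable_norm_bounded_clinear[OF assms s(2)]])
    show "f (x \<circ> y) = (\<Sum>n. cinner (\<xi> n) (x (y (\<eta> n))))" if "bounded_clinear x" for x
      using f[rule_format, OF bounded_clinear_comp[OF that assms]] by simp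
  qed
qed

lemma continuous_map_comp_left:
  assumes "bounded_clinear y"
  shows "continuous_map (ultraweak_topology operators) (ultraweak_topology operators) (\<lambda>x. y \<circ> x)"
proof (rule continuous_map_operators)
  show "x \<in> operators \<Longrightarrow> y \<circ> x \<in> operators" for x :: "'a \<Rightarrow> 'a"
    using assms bounded_clinear_comp by blast
next
  fix f :: "('a \<Rightarrow> 'a) \<Rightarrow> complex" and r assume "predual_norm_le f r"
  then obtain \<xi> \<eta> where s: "summable (\<lambda>n. (norm (\<xi> n))\<^sup>2)" "summable (\<lambda>n. (norm (\<eta> n))\<^sup>2)"
    and "(\<Sum>n. (norm (\<xi> n))\<^sup>2) \<le> r" "(\<Sum>n. (norm (\<eta> n))\<^sup>2) \<le> r"
    and f: "\<forall>x. bounded_clinear x \<longrightarrow> f x = (\<Sum>n. cinner (\<xi> n) (x (\<eta> n)))"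
    by (rule predual_norm_leE)
  show "\<exists>s. predual_norm_le (\<lambda>x. f (y \<circ> x)) s"
  proof (rule predual_norm_le_exists[OF summable_norm_bounded_clinear[OF bounded_clinear_op_adjoint[OF assms] s(1)] s(2)])
    show "f (y \<circ> x) = (\<Sum>n. cinner (op_adjoint y (\<xi> n)) (x (\<eta> n)))" if "bounded_clinear x" for x
      using f[rule_format, OF bounded_clinear_comp[OF assms that]] is_adjoint_op_adjoint[OF assms]
      by (simp add: is_adjoint_def)
  qed
qed

text \<open>
  Taking adjoints turns a normal functional into the complex conjugate of another one.
\<close>
lemma continuous_map_op_adjoint:
  "continuous_map (ultraweak_topology operators) (ultraweak_topology operators) op_adjoint"
proof (rule continuous_map_into_ultraweak)
  show "op_adjoint \<in> topspace (ultraweak_topology operators) \<rightarrow> operators"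
    using bounded_clinear_op_adjoint by auto
next
  fix f :: "('a \<Rightarrow> 'a) \<Rightarrow> complex" and r assume "predual_norm_le f r"
  then obtain \<xi> \<eta> where s: "summable (\<lambda>n. (norm (\<xi> n))\<^sup>2)" "summable (\<lambda>n. (norm (\<eta> n))\<^sup>2)"
    and "(\<Sum>n. (norm (\<xi> n))\<^sup>2) \<le> r" "(\<Sum>n. (norm (\<eta> n))\<^sup>2) \<le> r"
    and f: "\<forall>x. bounded_clinear x \<longrightarrow> f x = (\<Sum>n. cinner (\<xi> n) (x (\<eta> n)))"
    by (rule predual_norm_leE)
  have eq: "f (op_adjoint x) = cnj (\<Sum>n. cinner (\<eta> n) (x (\<xi> n)))" if x: "bounded_clinear x" for x
  proof -
    have "f (op_adjoint x) = (\<Sum>n. cinner (\<xi> n) (op_adjoint x (\<eta> n)))"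
      using f bounded_clinear_op_adjoint[OF x] by blast
    also have "(\<lambda>n. cinner (\<xi> n) (op_adjoint x (\<eta> n))) = (\<lambda>n. cnj (cinner (\<eta> n) (x (\<xi> n))))"
      using is_adjoint_op_adjoint[OF x] unfolding is_adjoint_def by (metis cinner_commute)
    also have "(\<Sum>n. cnj (cinner (\<eta> n) (x (\<xi> n)))) = cnj (\<Sum>n. cinner (\<eta> n) (x (\<xi> n)))"
      using summable_sums[OF summable_norm_cancel[OF summable_coefficients[OF s(2,1) x]]]
      by (intro sums_unique[symmetric]) (simp add: sums_cnj)
    finally show ?thesis .
  qed
  obtain s where "predual_norm_le (\<lambda>x. \<Sum>n. cinner (\<eta> n) (x (\<xi> n))) s"
    using predual_norm_le_exists[OF s(2,1), of "\<lambda>x. \<Sum>n. cinner (\<eta> n) (x (\<xi> n))"] by auto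
  then have "continuous_map (ultraweak_topology operators) euclidean (\<lambda>x. \<Sum>n. cinner (\<eta> n) (x (\<xi> n)))"
    by (rule continuous_map_ultraweak_functional[OF subset_refl])
  then have "continuous_map (ultraweak_topology operators) euclidean
      (cnj \<circ> (\<lambda>x. \<Sum>n. cinner (\<eta> n) (x (\<xi> n))))"
    by (rule continuous_map_compose) (simp add: continuous_on_cnj)
  then show "continuous_map (ultraweak_topology operators) euclidean (\<lambda>x. f (op_adjoint x))"
    by (rule continuous_map_eq) (auto simp: eq)
qed

section \<open>Von Neumann algebras generated by self-adjoint semigroups\<close>

definition uw_closed_subspace :: "('a::chilbert_space \<Rightarrow> 'a) set \<Rightarrow> bool" where
  "uw_closed_subspace L \<longleftrightarrow> closedin (ultraweak_topology operators) L \<and>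
     (\<forall>x\<in>L. \<forall>y\<in>L. \<forall>a b. op_lincomb a x b y \<in> L)"

lemma uw_closed_subspace_operators: "uw_closed_subspace operators"
  using closedin_topspace[of "ultraweak_topology operators"]
  by (auto simp: uw_closed_subspace_def bounded_clinear_lincomb)

lemma uw_closed_subspace_subset: "uw_closed_subspace L \<Longrightarrow> L \<subseteq> operators"
  using closedin_subset by (fastforce simp: uw_closed_subspace_def)

lemma uw_closed_subspace_Inter:
  assumes "\<And>L. L \<in> S \<Longrightarrow> uw_closed_subspace L" "S \<noteq> {}"
  shows "uw_closed_subspace (\<Inter>S)"
  using assms unfolding uw_closed_subspace_def by (intro conjI closedin_Inter) auto

text \<open>
  The function \<open>\<sigma>\<close> is the identity for linear \<open>T\<close> and complex conjugation for the adjoint.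
\<close>
lemma uw_closed_subspace_vimage:
  assumes L: "uw_closed_subspace L"
    and T: "continuous_map (ultraweak_topology operators) (ultraweak_topology operators) T"
    and lin: "\<And>x y a b. bounded_clinear x \<Longrightarrow> bounded_clinear y \<Longrightarrow>
      T (op_lincomb a x b y) = op_lincomb (\<sigma> a) (T x) (\<sigma> b) (T y)"
  shows "uw_closed_subspace {x \<in> operators. T x \<in> L}"
proof -
  have "closedin (ultraweak_topology operators) {x \<in> topspace (ultraweak_topology operators). T x \<in> L}"
    using closedin_continuous_map_preimage[OF T] L by (simp add: uw_closed_subspace_def)
  then show ?thesis
    using L lin by (simp add: uw_closed_subspace_def bounded_clinear_lincomb)
qed

lemma vn_algebra_imp_uw_closed_subspace: "vn_algebra M \<Longrightarrow> uw_closed_subspace M"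
  by (simp add: vn_algebra_def uw_closed_subspace_def)

text \<open>
  Density of the linear span of a self-adjoint multiplicative family \<open>G\<close> in the von Neumann algebra that it
  generates, as an induction principle. The smallest ultraweakly closed subspace \<open>C\<close> containing \<open>G\<close> is
  already a von Neumann algebra: multiplication is separately ultraweakly continuous and the
  adjoint is ultraweakly continuous, so the sets of \<open>x\<close> with \<open>x\<^sup>* \<in> C\<close>, with \<open>G x \<subseteq> C\<close> and with
  \<open>x C \<subseteq> C\<close> are closed subspaces containing \<open>G\<close>, hence contain \<open>C\<close>.
\<close>
lemma vn_hull_induct:
  assumes G: "G \<subseteq> operators" "id \<in> G" "\<And>x y. x \<in> G \<Longrightarrow> y \<in> G \<Longrightarrow> x \<circ> y \<in> G"
      "\<And>x. x \<in> G \<Longrightarrow> op_adjoint x \<in> G"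
    and x: "x \<in> vn_algebra hull G" and L: "uw_closed_subspace L" "G \<subseteq> L"
  shows "x \<in> L"
proof -
  define C where "C = \<Inter>{L. uw_closed_subspace L \<and> G \<subseteq> L}"
  have least: "C \<subseteq> L" if "uw_closed_subspace L" "G \<subseteq> L" for L
    using that by (auto simp: C_def)
  have GC: "G \<subseteq> C" by (auto simp: C_def)
  have C: "uw_closed_subspace C"
    unfolding C_def using uw_closed_subspace_operators G(1)
    by (intro uw_closed_subspace_Inter) auto
  have bd: "C \<subseteq> operators" by (rule uw_closed_subspace_subset[OF C])
  have "C \<subseteq> {x \<in> operators. op_adjoint x \<in> C}"
    using GC G bd
    by (intro least uw_closed_subspace_vimage[OF C continuous_map_op_adjoint, of cnj] op_adjoint_lincomb) auto
  then have adj: "op_adjoint x \<in> C" if "x \<in> C" for x using that by blast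
  have left: "y \<circ> x \<in> C" if y: "y \<in> G" and "x \<in> C" for x y
  proof -
    have "bounded_clinear y" using y G(1) by blast
    then have "C \<subseteq> {x \<in> operators. y \<circ> x \<in> C}"
      using GC G y bd
      by (intro least uw_closed_subspace_vimage[OF C continuous_map_comp_left, of y "\<lambda>a. a"])
        (auto simp: op_lincomb_def bounded_clinear_add bounded_clinear_scaleC)
    then show ?thesis using that by blast
  qed
  have mult: "y \<circ> x \<in> C" if x: "x \<in> C" and "y \<in> C" for x y
  proof -
    have "bounded_clinear x" using x bd by blast
    then have "C \<subseteq> {y \<in> operators. y \<circ> x \<in> C}"
      using GC G x bd left
      by (intro least uw_closed_subspace_vimage[OF C continuous_map_comp_right, of x "\<lambda>a. a"])
        (auto simp: op_lincomb_def)
    then show ?thesis using that by blast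
  qed
  have "\<exists>y\<in>C. is_adjoint y x" if "x \<in> C" for x
    using adj[OF that] is_adjoint_op_adjoint[of x] bd that by blast
  then have "vn_algebra C"
    unfolding vn_algebra_def
    using bd GC G(2) C mult by (auto simp: uw_closed_subspace_def)
  then have "vn_algebra hull G \<subseteq> C" by (rule hull_minimal[OF GC])
  with x least[OF L] show ?thesis by blast
qed

lemma vn_algebra_operators: "vn_algebra operators"
  using uw_closed_subspace_operators adjoint_exists bounded_clinear_id bounded_clinear_comp
  by (auto simp: vn_algebra_def uw_closed_subspace_def)

lemma vn_algebra_op_adjoint: "vn_algebra M \<Longrightarrow> x \<in> M \<Longrightarrow> op_adjoint x \<in> M"
  unfolding vn_algebra_def using op_adjoint_eqI by metis

text \<open>
  Intersections of nonempty families of von Neumann algebras are von Neumann algebras; the family is nonempty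
  because the algebra of all bounded operators belongs to it.
\<close>
lemma vn_algebra_hull:
  assumes "G \<subseteq> operators"
  shows "vn_algebra (vn_algebra hull G)"
proof -
  define S where "S = {M. vn_algebra M \<and> G \<subseteq> M}"
  have ne: "operators \<in> S" using assms vn_algebra_operators by (simp add: S_def)
  have vn: "\<And>M. M \<in> S \<Longrightarrow> vn_algebra M" by (simp add: S_def)
  have "uw_closed_subspace (\<Inter>S)"
    using vn ne by (intro uw_closed_subspace_Inter) (auto intro: vn_algebra_imp_uw_closed_subspace)
  moreover have "\<Inter>S \<subseteq> operators" using ne by blast
  moreover have "id \<in> \<Inter>S" "\<And>x y. x \<in> \<Inter>S \<Longrightarrow> y \<in> \<Inter>S \<Longrightarrow> x \<circ> y \<in> \<Inter>S"
    using vn by (auto simp: vn_algebra_def)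
  moreover have "\<exists>y\<in>\<Inter>S. is_adjoint y x" if x: "x \<in> \<Inter>S" for x
  proof
    show "is_adjoint (op_adjoint x) x" using x ne is_adjoint_op_adjoint by blast
    show "op_adjoint x \<in> \<Inter>S" using x vn vn_algebra_op_adjoint by blast
  qed
  ultimately have "vn_algebra (\<Inter>S)" by (auto simp: vn_algebra_def uw_closed_subspace_def)
  then show ?thesis by (simp add: hull_def S_def)
qed

section \<open>Tensor products of operators\<close>

text \<open>
  Grouping the terms of a sum of tensors by their second legs. The general target space is used both
  for the Hilbert space tensor product and for graphs of operators on it.
\<close>
lemma span_biadditive:
  fixes t :: "'a::real_vector \<Rightarrow> 'b \<Rightarrow> 'v::real_vector"
  assumes add: "\<And>a a' b. t (a + a') b = t a b + t a' b"
    and scale: "\<And>r a b. t (r *\<^sub>R a) b = r *\<^sub>R t a b"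
    and w: "w \<in> span {t a b | a b. True}"
  shows "\<exists>B A. finite B \<and> w = (\<Sum>b\<in>B. t (A b) b)"
  using w
proof (induction rule: span_induct_alt)
  case base
  show ?case by (intro exI[of _ "{}"]) simp
next
  case (step c x y)
  obtain a b where x: "x = t a b" using step(1) by auto
  obtain B A where BA: "finite B" "y = (\<Sum>b\<in>B. t (A b) b)" using step(2) by auto
  have zero: "t 0 b' = 0" for b' using scale[of 0 0 b'] by simp
  define A' where "A' = (\<lambda>b'. (if b' \<in> B then A b' else 0) + (if b' = b then c *\<^sub>R a else 0))"
  have "(\<Sum>b'\<in>insert b B. t (A' b') b') =
      (\<Sum>b'\<in>insert b B. t (if b' \<in> B then A b' else 0) b') +
      (\<Sum>b'\<in>insert b B. t (if b' = b then c *\<^sub>R a else 0) b')"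
    by (simp add: A'_def add sum.distrib)
  also have "(\<Sum>b'\<in>insert b B. t (if b' \<in> B then A b' else 0) b') = y"
    unfolding BA(2) by (rule sum.mono_neutral_cong_right) (use BA(1) zero in auto)
  also have "(\<Sum>b'\<in>insert b B. t (if b' = b then c *\<^sub>R a else 0) b') = (\<Sum>b'\<in>{b}. c *\<^sub>R t a b')"
    by (rule sum.mono_neutral_cong_right) (use BA(1) zero in \<open>auto simp: scale\<close>)
  finally show ?case
    using BA(1) x by (intro exI[of _ "insert b B"] exI[of _ A']) (simp add: add.commute)
qed

lemma hilbert_tensor_swap: "hilbert_tensor tens \<Longrightarrow> hilbert_tensor (\<lambda>b a. tens a b)"
proof -
  assume t: "hilbert_tensor tens"
  have "{tens a b | b a. True} = {tens a b | a b. True}" by auto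
  with t show ?thesis by (simp add: hilbert_tensor_def mult.commute)
qed

context hilbert_tensor
begin

lemma tens_scaleR_left: "tens (r *\<^sub>R a) b = r *\<^sub>R tens a b"
  by (simp add: scaleR_scaleC tens_scaleC_left)

lemma tens_zero_left [simp]: "tens 0 b = 0"
  using tens_scaleC_left[of 0 0 b] by simp

lemma tens_zero_right [simp]: "tens a 0 = 0"
  using tens_scaleC_right[of a 0 0] by simp

lemma tens_sum_left: "tens (\<Sum>i\<in>I. f i) b = (\<Sum>i\<in>I. tens (f i) b)"
  by (induction I rule: infinite_finite_induct) (auto simp: tens_add_left)

lemma tens_sum_right: "tens a (\<Sum>i\<in>I. f i) = (\<Sum>i\<in>I. tens a (f i))"
  by (induction I rule: infinite_finite_induct) (auto simp: tens_add_right)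

lemma norm_tens: "norm (tens a b) = norm a * norm b"
proof -
  have "complex_of_real ((norm (tens a b))\<^sup>2) = complex_of_real ((norm a * norm b)\<^sup>2)"
    by (simp only: cinner_self[symmetric] cinner_tens) (simp add: cinner_self power_mult_distrib)
  then have "(norm (tens a b))\<^sup>2 = (norm a * norm b)\<^sup>2"
    by (simp only: of_real_eq_iff)
  then show ?thesis by (simp add: power2_eq_iff_nonneg)
qed

abbreviation algebraic_tensor :: "'k set" where
  "algebraic_tensor \<equiv> span {tens a b | a b. True}"

lemma eq_on_tens_imp_eq:
  assumes "bounded_clinear z" "bounded_clinear z'" "\<And>a b. z (tens a b) = z' (tens a b)"
  shows "z = z'"
proof
  fix u
  have lin: "bounded_linear z" "bounded_linear z'"
    using assms by (auto simp: bounded_clinear_def)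
  have "closed {u. z u = z' u}"
    by (intro closed_Collect_eq linear_continuous_on lin)
  moreover have "subspace {u. z u = z' u}"
    using lin by (auto simp: subspace_def linear_0 linear_add linear_cmul bounded_linear.linear)
  ultimately have "closure algebraic_tensor \<subseteq> {u. z u = z' u}"
    using assms(3) by (intro closure_minimal span_minimal) auto
  then show "z u = z' u" using tens_total by auto
qed

lemma reexpand_second_legs:
  assumes "\<And>b. b \<in> B \<Longrightarrow> b = (\<Sum>e\<in>E. c b e *\<^sub>C e)"
  shows "(\<Sum>b\<in>B. tens (A b) b) = (\<Sum>e\<in>E. tens (\<Sum>b\<in>B. c b e *\<^sub>C A b) e)"
proof -
  have "(\<Sum>b\<in>B. tens (A b) b) = (\<Sum>b\<in>B. tens (A b) (\<Sum>e\<in>E. c b e *\<^sub>C e))"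
    by (rule sum.cong) (use assms in auto)
  also have "\<dots> = (\<Sum>b\<in>B. \<Sum>e\<in>E. tens (c b e *\<^sub>C A b) e)"
    by (simp add: tens_sum_right tens_scaleC_right tens_scaleC_left)
  also have "\<dots> = (\<Sum>e\<in>E. \<Sum>b\<in>B. tens (c b e *\<^sub>C A b) e)"
    by (rule sum.swap)
  finally show ?thesis by (simp add: tens_sum_left)
qed

text \<open>
  Finitely many vectors of the algebraic tensor product can be expanded along one and the same
  finite orthogonal family of second legs. In such an expansion inner products are sums over the
  family, and \<open>x \<otimes> 1\<close> acts on each coefficient separately.
\<close>
lemma algebraic_tensor_orthogonal:
  assumes "finite I" "\<And>i. i \<in> I \<Longrightarrow> u i \<in> algebraic_tensor"
  shows "\<exists>E A. finite E \<and> (\<forall>e\<in>E. \<forall>e'\<in>E. e \<noteq> e' \<longrightarrow> cinner e e' = 0) \<and>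
    (\<forall>i\<in>I. u i = (\<Sum>e\<in>E. tens (A i e) e))"
proof -
  have "\<forall>i\<in>I. \<exists>BA. finite (fst BA) \<and> u i = (\<Sum>b\<in>fst BA. tens (snd BA b) b)"
    using span_biadditive[of tens, OF tens_add_left tens_scaleR_left] assms(2) by fastforce
  from bchoice[OF this] obtain BA where
    BA: "\<And>i. i \<in> I \<Longrightarrow> finite (fst (BA i))" "\<And>i. i \<in> I \<Longrightarrow> u i = (\<Sum>b\<in>fst (BA i). tens (snd (BA i) b) b)"
    by blast
  define B where "B = (\<Union>i\<in>I. fst (BA i))"
  define A where "A = (\<lambda>i b. if b \<in> fst (BA i) then snd (BA i) b else 0)"
  have "finite B" using BA(1) assms(1) by (auto simp: B_def)
  have u: "u i = (\<Sum>b\<in>B. tens (A i b) b)" if "i \<in> I" for i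
    unfolding BA(2)[OF that] A_def
    by (rule sum.mono_neutral_cong_left) (use \<open>finite B\<close> that in \<open>auto simp: B_def\<close>)
  obtain E c where E: "finite E" "\<forall>e\<in>E. \<forall>e'\<in>E. e \<noteq> e' \<longrightarrow> cinner e e' = 0"
    "\<forall>b\<in>B. b = (\<Sum>e\<in>E. c b e *\<^sub>C e)"
    using orthogonalise[OF \<open>finite B\<close>] by blast
  have "u i = (\<Sum>e\<in>E. tens (\<Sum>b\<in>B. c b e *\<^sub>C A i b) e)" if "i \<in> I" for i
    unfolding u[OF that] by (rule reexpand_second_legs) (use E(3) in blast)
  with E(1,2) show ?thesis
    by (intro exI[of _ E] exI[of _ "\<lambda>i e. \<Sum>b\<in>B. c b e *\<^sub>C A i b"]) simp
qed

lemma cinner_orthogonal: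
  assumes "finite E" "\<forall>e\<in>E. \<forall>e'\<in>E. e \<noteq> e' \<longrightarrow> cinner e e' = 0"
  shows "cinner (\<Sum>e\<in>E. tens (A e) e) (\<Sum>e\<in>E. tens (A' e) e) =
    (\<Sum>e\<in>E. complex_of_real ((norm e)\<^sup>2) * cinner (A e) (A' e))"
proof -
  have "(\<Sum>e'\<in>E. cinner (A e) (A' e') * cinner e e') = cinner (A e) (A' e) * cinner e e"
    if "e \<in> E" for e
  proof -
    have "(\<Sum>e'\<in>E. cinner (A e) (A' e') * cinner e e') = (\<Sum>e'\<in>{e}. cinner (A e) (A' e') * cinner e e')"
      by (rule sum.mono_neutral_right) (use assms that in auto)
    then show ?thesis by simp
  qed
  then show ?thesis
    by (simp add: cinner_sum_left cinner_sum_right cinner_tens cinner_self mult.commute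
        sum.swap[of _ E E] cong: sum.cong)
qed

lemma norm_orthogonal:
  assumes "finite E" "\<forall>e\<in>E. \<forall>e'\<in>E. e \<noteq> e' \<longrightarrow> cinner e e' = 0"
  shows "(norm (\<Sum>e\<in>E. tens (A e) e))\<^sup>2 = (\<Sum>e\<in>E. (norm e)\<^sup>2 * (norm (A e))\<^sup>2)"
proof -
  have "complex_of_real ((norm (\<Sum>e\<in>E. tens (A e) e))\<^sup>2) =
      complex_of_real (\<Sum>e\<in>E. (norm e)\<^sup>2 * (norm (A e))\<^sup>2)"
    unfolding cinner_self[symmetric] cinner_orthogonal[OF assms] by (simp add: cinner_self)
  then show ?thesis by (simp only: of_real_eq_iff)
qed

text \<open>
  The bound \<open>\<parallel>(x \<otimes> 1) u\<parallel> \<le> \<parallel>x\<parallel> \<parallel>u\<parallel>\<close> holds on the algebraic tensor product, termwise in an expansion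
  along orthogonal second legs, so \<open>x \<otimes> 1\<close> extends by continuity.
\<close>
lemma amplification_exists:
  assumes x: "bounded_clinear x"
  shows "\<exists>z. bounded_clinear z \<and> (\<forall>a b. z (tens a b) = tens (x a) b)"
proof -
  obtain K where K: "K \<ge> 0" "\<And>u. norm (x u) \<le> K * norm u"
    using bounded_clinear_bound[OF x] by blast
  \<comment> \<open>The graph of \<open>x \<otimes> 1\<close> is spanned by the range of the biadditive map \<open>t\<close>.\<close>
  define t where "t = (\<lambda>a b. (tens a b, tens (x a) b))"
  define S where "S = {t a b | a b. True}"
  have t: "t (a + a') b = t a b + t a' b" "t (r *\<^sub>R a) b = r *\<^sub>R t a b" for a a' b r
    by (simp_all add: t_def tens_add_left tens_scaleR_left bounded_clinear_add[OF x]
        scaleR_scaleC bounded_clinear_scaleC[OF x] tens_scaleC_left)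
  have "\<exists>T. bounded_clinear T \<and> (\<forall>u v. (u, v) \<in> S \<longrightarrow> T u = v)"
  proof (rule bounded_clinear_extension)
    show "(c *\<^sub>C u, c *\<^sub>C v) \<in> S" if uv: "(u, v) \<in> S" for c u v
    proof -
      obtain a b where "u = tens a b" "v = tens (x a) b" using uv by (auto simp: S_def t_def)
      then have "(c *\<^sub>C u, c *\<^sub>C v) = t (c *\<^sub>C a) b"
        by (simp add: t_def bounded_clinear_scaleC[OF x] tens_scaleC_left)
      then show ?thesis unfolding S_def by blast
    qed
  next
    fix u v assume "(u, v) \<in> span S"
    then obtain B A where B: "finite B" "(u, v) = (\<Sum>b\<in>B. t (A b) b)"
      using span_biadditive[of t, OF t] unfolding S_def by blast
    then have uv: "u = (\<Sum>b\<in>B. tens (A b) b)" "v = (\<Sum>b\<in>B. tens (x (A b)) b)"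
      by (simp_all add: t_def sum_prod)
    obtain E c where E: "finite E" "\<forall>e\<in>E. \<forall>e'\<in>E. e \<noteq> e' \<longrightarrow> cinner e e' = 0"
      "\<forall>b\<in>B. b = (\<Sum>e\<in>E. c b e *\<^sub>C e)"
      using orthogonalise[OF B(1)] by blast
    define A' where "A' = (\<lambda>e. \<Sum>b\<in>B. c b e *\<^sub>C A b)"
    have u: "u = (\<Sum>e\<in>E. tens (A' e) e)"
      unfolding uv A'_def by (rule reexpand_second_legs) (use E(3) in blast)
    have "v = (\<Sum>e\<in>E. tens (\<Sum>b\<in>B. c b e *\<^sub>C x (A b)) e)"
      unfolding uv by (rule reexpand_second_legs) (use E(3) in blast)
    then have v: "v = (\<Sum>e\<in>E. tens (x (A' e)) e)"
      by (simp add: A'_def bounded_clinear_sum[OF x] bounded_clinear_scaleC[OF x])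
    have "(norm v)\<^sup>2 \<le> (\<Sum>e\<in>E. (norm e)\<^sup>2 * (K * norm (A' e))\<^sup>2)"
      unfolding v norm_orthogonal[OF E(1,2)]
      by (intro sum_mono mult_left_mono power_mono K) auto
    also have "\<dots> = (K * norm u)\<^sup>2"
      unfolding u power_mult_distrib norm_orthogonal[OF E(1,2)]
      by (simp add: sum_distrib_left mult_ac)
    finally show "norm v \<le> K * norm u"
      by (rule power2_le_imp_le) (use K in simp)
  next
    have "fst ` span S = span (fst ` S)"
      by (rule linear_span_image[symmetric]) (simp add: linear_fst)
    also have "fst ` S = {tens a b | a b. True}"
      by (force simp: S_def t_def image_iff)
    finally show "closure (fst ` span S) = UNIV" using tens_total by simp
  qed
  then obtain T where "bounded_clinear T" "\<And>u v. (u, v) \<in> S \<Longrightarrow> T u = v" by blast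
  moreover have "(tens a b, tens (x a) b) \<in> S" for a b unfolding S_def t_def by blast
  ultimately show ?thesis by blast
qed

end

text \<open>
  \<open>x \<otimes> y\<close> is the product of \<open>x \<otimes> 1\<close> and \<open>1 \<otimes> y\<close>, and the latter is an amplification for the tensor
  product with exchanged factors.
\<close>
lemma (in hilbert_tensor) tensor_operator_exists:
  assumes "bounded_clinear x" "bounded_clinear y"
  shows "\<exists>z. bounded_clinear z \<and> (\<forall>a b. z (tens a b) = tens (x a) (y b))"
proof -
  interpret swap: hilbert_tensor "\<lambda>b a. tens a b"
    by (rule hilbert_tensor_swap) (rule hilbert_tensor_axioms)
  obtain z where z: "bounded_clinear z" "\<forall>a b. z (tens a b) = tens (x a) b"
    using amplification_exists[OF assms(1)] by blast
  obtain z' where z': "bounded_clinear z'" "\<forall>b a. z' (tens a b) = tens a (y b)"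
    using swap.amplification_exists[OF assms(2)] by blast
  show ?thesis
    using bounded_clinear_comp[OF z(1) z'(1)] z(2) z'(2) by (intro exI[of _ "z \<circ> z'"]) simp
qed

context hilbert_tensor
begin

lemma op_tensor_eqI:
  assumes "bounded_clinear z" "\<And>a b. z (tens a b) = tens (x a) (y b)"
  shows "op_tensor tens x y = z"
  unfolding op_tensor_def
proof (rule the_equality)
  show "bounded_clinear z \<and> (\<forall>\<xi> \<eta>. z (tens \<xi> \<eta>) = tens (x \<xi>) (y \<eta>))"
    using assms by simp
  show "z' = z" if "bounded_clinear z' \<and> (\<forall>\<xi> \<eta>. z' (tens \<xi> \<eta>) = tens (x \<xi>) (y \<eta>))" for z'
    using that assms by (intro eq_on_tens_imp_eq) auto
qed

lemma op_tensor_props: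
  assumes "bounded_clinear x" "bounded_clinear y"
  shows bounded_clinear_op_tensor: "bounded_clinear (op_tensor tens x y)"
    and op_tensor_apply: "op_tensor tens x y (tens a b) = tens (x a) (y b)"
proof -
  obtain z where z: "bounded_clinear z" "\<And>a b. z (tens a b) = tens (x a) (y b)"
    using tensor_operator_exists[OF assms] by blast
  then have "op_tensor tens x y = z" by (rule op_tensor_eqI)
  with z show "bounded_clinear (op_tensor tens x y)" "op_tensor tens x y (tens a b) = tens (x a) (y b)"
    by simp_all
qed

lemma op_tensor_id: "op_tensor tens id id = id"
  by (rule op_tensor_eqI) (auto intro: bounded_clinear_id)

lemma op_tensor_comp:
  assumes "bounded_clinear x" "bounded_clinear y" "bounded_clinear x'" "bounded_clinear y'"
  shows "op_tensor tens x y \<circ> op_tensor tens x' y' = op_tensor tens (x \<circ> x') (y \<circ> y')"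
  using assms
  by (intro op_tensor_eqI[symmetric]) (auto simp: op_tensor_apply intro!: bounded_clinear_comp bounded_clinear_op_tensor)

lemma op_tensor_lincomb_left:
  assumes "bounded_clinear x" "bounded_clinear x'" "bounded_clinear y"
  shows "op_tensor tens (op_lincomb c x d x') y = op_lincomb c (op_tensor tens x y) d (op_tensor tens x' y)"
  using assms
  by (intro op_tensor_eqI bounded_clinear_lincomb bounded_clinear_op_tensor)
    (auto simp: op_lincomb_def op_tensor_apply tens_add_left tens_scaleC_left)

lemma op_tensor_adjoint:
  assumes "bounded_clinear x" "bounded_clinear x'" "bounded_clinear y" "bounded_clinear y'"
    and "is_adjoint x' x" "is_adjoint y' y"
  shows "is_adjoint (op_tensor tens x' y') (op_tensor tens x y)"
proof -
  obtain w where w: "bounded_clinear w" "is_adjoint w (op_tensor tens x y)"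
    using adjoint_exists bounded_clinear_op_tensor assms by blast
  \<comment> \<open>The adjoint of \<open>x \<otimes> y\<close> is identified by its inner products with simple tensors, which are total.\<close>
  have dense: "u = v" if "\<And>a b. cinner (tens a b) u = cinner (tens a b) v" for u v
  proof -
    have bl: "bounded_linear (\<lambda>w. cinner w u)" "bounded_linear (\<lambda>w. cinner w v)"
      by (rule bounded_bilinear.bounded_linear_left[OF bounded_bilinear_cinner])+
    have "closure algebraic_tensor \<subseteq> {w. cinner w u = cinner w v}"
    proof (intro closure_minimal span_minimal)
      show "closed {w. cinner w u = cinner w v}" by (intro closed_Collect_eq linear_continuous_on bl)
      show "subspace {w. cinner w u = cinner w v}"
        by (auto simp: subspace_def cinner_add_left scaleR_scaleC cinner_scaleC_left)
    qed (use that in auto)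
    then show "u = v" using tens_total by (intro cinner_ext) auto
  qed
  have "w (tens a b) = tens (x' a) (y' b)" for a b
  proof (rule dense)
    fix a' b'
    have "cinner (w (tens a b)) (tens a' b') = cinner (tens a b) (op_tensor tens x y (tens a' b'))"
      using w(2) by (simp add: is_adjoint_def)
    also have "\<dots> = cinner (tens (x' a) (y' b)) (tens a' b')"
      using assms by (simp add: op_tensor_apply cinner_tens is_adjoint_def)
    finally show "cinner (tens a' b') (w (tens a b)) = cinner (tens a' b') (tens (x' a) (y' b))"
      by (metis cinner_commute)
  qed
  then have "op_tensor tens x' y' = w" by (intro op_tensor_eqI w)
  with w show ?thesis by simp
qed

lemma op_tensor_id_apply_sum:
  assumes "bounded_clinear x"
  shows "op_tensor tens x id (\<Sum>e\<in>E. tens (A e) e) = (\<Sum>e\<in>E. tens (x (A e)) e)"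
  using assms
  by (simp add: bounded_clinear_sum[OF bounded_clinear_op_tensor] bounded_clinear_id op_tensor_apply)

end

section \<open>The amplification is completely positive and normal\<close>

lemma sum_nonneg_Reals: "(\<And>i. i \<in> I \<Longrightarrow> f i \<in> \<real>\<^sub>\<ge>\<^sub>0) \<Longrightarrow> (\<Sum>i\<in>I. f i :: complex) \<in> \<real>\<^sub>\<ge>\<^sub>0"
  by (induction I rule: infinite_finite_induct) auto

context hilbert_tensor
begin

text \<open>
  On vectors expanded along orthogonal second legs \<open>e\<close>, the quadratic form of \<open>(x i j \<otimes> 1)\<close> is the sum over
  \<open>e\<close> of \<open>\<parallel>e\<parallel>\<^sup>2\<close> times the form of \<open>(x i j)\<close> at the coefficients of \<open>e\<close>. Such vectors are dense and the set of
  nonnegative numbers is closed.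
\<close>
lemma positive_op_matrix_amplification:
  assumes x: "\<And>i j. i < n \<Longrightarrow> j < n \<Longrightarrow> bounded_clinear (x i j)" and pos: "positive_op_matrix n x"
  shows "positive_op_matrix n (\<lambda>i j. op_tensor tens (x i j) id)"
proof -
  define q where
    "q = (\<lambda>\<xi>. \<Sum>i<n. \<Sum>j<n. cinner (\<xi> i) (op_tensor tens (x i j) id (\<xi> j)))"
  have alg: "q \<xi> \<in> \<real>\<^sub>\<ge>\<^sub>0" if \<xi>: "\<And>i. i < n \<Longrightarrow> \<xi> i \<in> algebraic_tensor" for \<xi>
  proof -
    have "\<exists>E A. finite E \<and> (\<forall>e\<in>E. \<forall>e'\<in>E. e \<noteq> e' \<longrightarrow> cinner e e' = 0) \<and>
        (\<forall>i\<in>{..<n}. \<xi> i = (\<Sum>e\<in>E. tens (A i e) e))"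
      by (rule algebraic_tensor_orthogonal) (use \<xi> in auto)
    then obtain E A where E: "finite E" "\<forall>e\<in>E. \<forall>e'\<in>E. e \<noteq> e' \<longrightarrow> cinner e e' = 0"
      and A': "\<forall>i\<in>{..<n}. \<xi> i = (\<Sum>e\<in>E. tens (A i e) e)" by (elim exE conjE)
    have A: "\<xi> i = (\<Sum>e\<in>E. tens (A i e) e)" if "i < n" for i
      using bspec[OF A', of i] that by simp
    have "q \<xi> = (\<Sum>i<n. \<Sum>j<n. \<Sum>e\<in>E. complex_of_real ((norm e)\<^sup>2) * cinner (A i e) (x i j (A j e)))"
      unfolding q_def
      by (intro sum.cong refl) (simp add: A op_tensor_id_apply_sum x cinner_orthogonal[OF E])
    also have "\<dots> = (\<Sum>i<n. \<Sum>e\<in>E. \<Sum>j<n. complex_of_real ((norm e)\<^sup>2) * cinner (A i e) (x i j (A j e)))"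
      by (intro sum.cong refl sum.swap)
    also have "\<dots> = (\<Sum>e\<in>E. \<Sum>i<n. \<Sum>j<n. complex_of_real ((norm e)\<^sup>2) * cinner (A i e) (x i j (A j e)))"
      by (rule sum.swap)
    also have "\<dots> = (\<Sum>e\<in>E. complex_of_real ((norm e)\<^sup>2) * (\<Sum>i<n. \<Sum>j<n. cinner (A i e) (x i j (A j e))))"
      by (simp add: sum_distrib_left)
    also have "\<dots> \<in> \<real>\<^sub>\<ge>\<^sub>0"
    proof (rule sum_nonneg_Reals, rule nonneg_Reals_mult_I)
      show "(\<Sum>i<n. \<Sum>j<n. cinner (A i e) (x i j (A j e))) \<in> \<real>\<^sub>\<ge>\<^sub>0" for e
        using spec[OF pos[unfolded positive_op_matrix_def], of "\<lambda>i. A i e"] .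
    qed simp
    finally show ?thesis .
  qed
  have "q \<xi> \<in> \<real>\<^sub>\<ge>\<^sub>0" for \<xi>
  proof -
    have "\<exists>U. (\<forall>k. U k \<in> algebraic_tensor) \<and> U \<longlonglongrightarrow> \<xi> i" for i
      using tens_total closure_sequential[of "\<xi> i" algebraic_tensor] by auto
    then obtain U where U: "\<And>i k. U i k \<in> algebraic_tensor" "\<And>i. U i \<longlonglongrightarrow> \<xi> i" by metis
    have "(\<lambda>k. q (\<lambda>i. U i k)) \<longlonglongrightarrow> q \<xi>"
      unfolding q_def
    proof (intro tendsto_sum bounded_bilinear.tendsto[OF bounded_bilinear_cinner] U(2))
      fix i j assume "i \<in> {..<n}" "j \<in> {..<n}"
      then show "(\<lambda>k. op_tensor tens (x i j) id (U j k)) \<longlonglongrightarrow> op_tensor tens (x i j) id (\<xi> j)"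
        by (intro bounded_clinear_tendsto[OF bounded_clinear_op_tensor] U(2) x bounded_clinear_id) auto
    qed
    then show ?thesis
      by (rule closed_sequentially[OF closed_nonneg_Reals_complex, rotated]) (rule alg, rule U(1))
  qed
  then show ?thesis unfolding positive_op_matrix_def q_def by blast
qed

text \<open>
  The expansion along orthogonal second legs bounds the predual norm by \<open>\<parallel>u\<parallel>\<^sup>2 + \<parallel>v\<parallel>\<^sup>2\<close>. Replacing \<open>u\<close> by
  \<open>c u\<close> and \<open>v\<close> by \<open>v / c\<close> leaves the functional unchanged and, with \<open>c\<^sup>2 = \<parallel>v\<parallel> / \<parallel>u\<parallel>\<close>, turns the bound into
  a multiple of \<open>\<parallel>u\<parallel> \<parallel>v\<parallel>\<close>. Only such a product bound survives summation over two independent series.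
\<close>
lemma predual_amplification_algebraic:
  assumes u: "u \<in> algebraic_tensor" and v: "v \<in> algebraic_tensor"
  shows "predual_norm_le (\<lambda>x. cinner u (op_tensor tens x id v)) (2 * norm u * norm v)"
proof (cases "u = 0 \<or> v = 0")
  case True
  show ?thesis
  proof (rule predual_norm_le_cong)
    show "predual_norm_le (\<lambda>_. 0) (2 * norm u * norm v)" using True predual_norm_le_zero by auto
  next
    fix x :: "'a \<Rightarrow> 'a" assume "bounded_clinear x"
    then have "bounded_clinear (op_tensor tens x id)"
      using bounded_clinear_op_tensor bounded_clinear_id by blast
    then have "op_tensor tens x id 0 = 0" using bounded_clinear_sum[of _ _ "{}"] by fastforce
    with True show "cinner u (op_tensor tens x id v) = 0" by auto
  qed
next
  case False
  have sum_bound: "predual_norm_le (\<lambda>x. cinner u' (op_tensor tens x id v')) ((norm u')\<^sup>2 + (norm v')\<^sup>2)"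
    if uv: "u' \<in> algebraic_tensor" "v' \<in> algebraic_tensor" for u' v'
  proof -
    have "\<exists>E A. finite E \<and> (\<forall>e\<in>E. \<forall>e'\<in>E. e \<noteq> e' \<longrightarrow> cinner e e' = 0) \<and>
        (\<forall>i\<in>{True, False}. (if i then u' else v') = (\<Sum>e\<in>E. tens (A i e) e))"
      by (rule algebraic_tensor_orthogonal) (use uv in auto)
    then obtain E A where E: "finite E" "\<forall>e\<in>E. \<forall>e'\<in>E. e \<noteq> e' \<longrightarrow> cinner e e' = 0"
      and A: "u' = (\<Sum>e\<in>E. tens (A True e) e)" "v' = (\<Sum>e\<in>E. tens (A False e) e)" by auto
    define a where "a = (\<lambda>e. norm e *\<^sub>R A True e)"
    define b where "b = (\<lambda>e. norm e *\<^sub>R A False e)"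
    have "predual_norm_le (\<lambda>x. \<Sum>e\<in>E. cinner (a e) (x (b e))) (\<Sum>e\<in>E. (norm (a e))\<^sup>2 + (norm (b e))\<^sup>2)"
      by (intro predual_norm_le_finite_sum predual_norm_le_coefficient E) auto
    also have "(\<Sum>e\<in>E. (norm (a e))\<^sup>2 + (norm (b e))\<^sup>2) = (norm u')\<^sup>2 + (norm v')\<^sup>2"
      unfolding A norm_orthogonal[OF E] by (simp add: a_def b_def power_mult_distrib sum.distrib)
    finally show ?thesis
    proof (rule predual_norm_le_cong)
      fix x :: "'a \<Rightarrow> 'a" assume x: "bounded_clinear x"
      show "cinner u' (op_tensor tens x id v') = (\<Sum>e\<in>E. cinner (a e) (x (b e)))"
        unfolding A op_tensor_id_apply_sum[OF x] cinner_orthogonal[OF E]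
        by (simp add: a_def b_def scaleR_scaleC bounded_clinear_scaleC[OF x] cinner_scaleC_left
            cinner_scaleC_right power2_eq_square mult.assoc)
    qed
  qed
  define c where "c = sqrt (norm v / norm u)"
  have c: "c > 0" using False by (simp add: c_def)
  have c2: "c\<^sup>2 = norm v / norm u" by (simp add: c_def)
  have "predual_norm_le (\<lambda>x. cinner (c *\<^sub>R u) (op_tensor tens x id ((1 / c) *\<^sub>R v)))
      ((norm (c *\<^sub>R u))\<^sup>2 + (norm ((1 / c) *\<^sub>R v))\<^sup>2)"
    by (intro sum_bound span_scale u v)
  also have "(norm (c *\<^sub>R u))\<^sup>2 + (norm ((1 / c) *\<^sub>R v))\<^sup>2 = 2 * norm u * norm v"
    using False by (simp add: power_mult_distrib power_divide c2) (simp add: power2_eq_square)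
  finally show ?thesis
  proof (rule predual_norm_le_cong)
    fix x :: "'a \<Rightarrow> 'a" assume "bounded_clinear x"
    then have z: "bounded_clinear (op_tensor tens x id)"
      using bounded_clinear_op_tensor bounded_clinear_id by blast
    show "cinner u (op_tensor tens x id v) = cinner (c *\<^sub>R u) (op_tensor tens x id ((1 / c) *\<^sub>R v))"
      using c by (simp add: scaleR_scaleC bounded_clinear_scaleC[OF z] cinner_scaleC_left cinner_scaleC_right)
  qed
qed

text \<open>
  An arbitrary vector is approximated geometrically fast by vectors of the algebraic tensor product,
  and the differences of consecutive approximations are summed. The constant \<open>3\<close> makes room for the errors
  of both neighbours.
\<close>
lemma rapid_series:
  "\<exists>v. (\<forall>j. v j \<in> algebraic_tensor) \<and> v sums \<zeta> \<and> (\<forall>j. norm (v j) \<le> 3 * norm \<zeta> * (1/2) ^ j)"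
proof (cases "\<zeta> = 0")
  case True
  then show ?thesis by (intro exI[of _ "\<lambda>_. 0"]) (simp add: span_zero)
next
  case False
  have "\<exists>w\<in>algebraic_tensor. dist w \<zeta> < norm \<zeta> * (1/2) ^ j" for j :: nat
    using tens_total closure_approachable[of \<zeta> algebraic_tensor] False by simp
  then obtain w where w: "\<And>j. w j \<in> algebraic_tensor" "\<And>j. dist (w j) \<zeta> < norm \<zeta> * (1/2) ^ j"
    by metis
  \<comment> \<open>Starting the approximations at \<open>0\<close> lets the series telescope to \<open>\<zeta>\<close> itself.\<close>
  define W where "W = (\<lambda>j. case j of 0 \<Rightarrow> 0 | Suc i \<Rightarrow> w i)"
  define v where "v = (\<lambda>j. W (Suc j) - W j)"
  have "w \<longlonglongrightarrow> \<zeta>"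
  proof (rule metric_tendsto_imp_tendsto)
    show "(\<lambda>j. norm \<zeta> * (1/2) ^ j :: real) \<longlonglongrightarrow> norm \<zeta> * 0"
      by (intro tendsto_mult tendsto_const LIMSEQ_power_zero) simp
    show "\<forall>\<^sub>F j in sequentially. dist (w j) \<zeta> \<le> dist (norm \<zeta> * (1/2) ^ j) (norm \<zeta> * 0)"
      using w(2) by (intro always_eventually allI) (auto simp: dist_norm intro: less_imp_le)
  qed
  then have "W \<longlonglongrightarrow> \<zeta>" unfolding W_def by (subst filterlim_sequentially_Suc[symmetric]) simp
  then have "v sums (\<zeta> - W 0)" unfolding v_def by (rule telescope_sums)
  then have "v sums \<zeta>" by (simp add: W_def)
  moreover have "v j \<in> algebraic_tensor" for j
  proof -
    have "W i \<in> algebraic_tensor" for i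
      unfolding W_def using w(1) by (cases i) (simp_all only: nat.case span_zero)
    then show ?thesis unfolding v_def by (intro span_diff)
  qed
  moreover have "norm (v j) \<le> 3 * norm \<zeta> * (1/2) ^ j" for j
  proof (cases j)
    case 0
    have "norm (w 0) \<le> dist (w 0) \<zeta> + norm \<zeta>"
      using norm_triangle_ineq[of "w 0 - \<zeta>" \<zeta>] by (simp add: dist_norm)
    moreover have "dist (w 0) \<zeta> < norm \<zeta>" using w(2)[of 0] by simp
    ultimately have "norm (w 0) \<le> 3 * norm \<zeta>" using norm_ge_zero[of \<zeta>] by linarith
    then show ?thesis using 0 by (simp add: v_def W_def)
  next
    case (Suc i)
    have "norm (v j) = dist (w (Suc i)) (w i)" by (simp add: v_def W_def Suc dist_norm)
    also have "\<dots> \<le> dist (w (Suc i)) \<zeta> + dist (w i) \<zeta>" by (rule dist_triangle2)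
    also have "\<dots> \<le> norm \<zeta> * (1/2) ^ Suc i + norm \<zeta> * (1/2) ^ i"
      using w(2)[of i] w(2)[of "Suc i"] by linarith
    also have "\<dots> = 3 * norm \<zeta> * (1/2) ^ j" by (simp add: Suc)
    finally show ?thesis .
  qed
  ultimately show ?thesis by blast
qed

text \<open>
  Both vectors are expanded into rapidly converging series, one after the other; each series costs
  the factor \<open>3 * (\<Sum>j. (1/2) ^ j) = 6\<close>, so the constant is \<open>2 * 6 * 6\<close>.
\<close>
lemma predual_amplification_coefficient:
  "predual_norm_le (\<lambda>x. cinner \<xi> (op_tensor tens x id \<eta>)) (72 * norm \<xi> * norm \<eta>)"
proof -
  obtain u where u: "\<And>j. u j \<in> algebraic_tensor" "u sums \<xi>" "\<And>j. norm (u j) \<le> 3 * norm \<xi> * (1/2) ^ j"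
    using rapid_series[of \<xi>] by auto
  obtain v where v: "\<And>j. v j \<in> algebraic_tensor" "v sums \<eta>" "\<And>j. norm (v j) \<le> 3 * norm \<eta> * (1/2) ^ j"
    using rapid_series[of \<eta>] by auto
  have geo: "(\<lambda>j. (1/2) ^ j :: real) sums 2" using geometric_sums[of "1/2 :: real"] by simp
  have z: "bounded_clinear (op_tensor tens x id)" if "bounded_clinear x" for x
    using bounded_clinear_op_tensor bounded_clinear_id that by blast
  have step: "predual_norm_le (\<lambda>x. cinner (u i) (op_tensor tens x id \<eta>)) (6 * norm (u i) * norm \<eta> * 2)" for i
  proof -
    define r where "r = (\<lambda>j. (6 * norm (u i) * norm \<eta>) * (1/2) ^ j :: real)"
    have r: "r sums (6 * norm (u i) * norm \<eta> * 2)" unfolding r_def by (rule sums_mult[OF geo])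
    have "predual_norm_le (\<lambda>x. cinner (u i) (op_tensor tens x id \<eta>)) (\<Sum>j. r j)"
    proof (rule predual_norm_le_sums)
      show "predual_norm_le (\<lambda>x. cinner (u i) (op_tensor tens x id (v j))) (r j)" for j
        using mult_left_mono[OF v(3)[of j], of "2 * norm (u i)"]
        by (intro predual_norm_le_mono[OF predual_amplification_algebraic[OF u(1) v(1)]])
          (simp add: r_def mult_ac)
      show "summable r" using r by (rule sums_summable)
    next
      fix x :: "'a \<Rightarrow> 'a" assume x: "bounded_clinear x"
      then have "bounded_linear (op_tensor tens x id)" using z by (simp add: bounded_clinear_def)
      from bounded_linear.sums[OF bounded_linear_compose[OF
          bounded_bilinear.bounded_linear_right[OF bounded_bilinear_cinner] this] v(2)]
      show "(\<lambda>j. cinner (u i) (op_tensor tens x id (v j))) sums cinner (u i) (op_tensor tens x id \<eta>)" .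
    qed
    then show ?thesis by (simp only: sums_unique[OF r, symmetric])
  qed
  define r where "r = (\<lambda>j. (36 * norm \<xi> * norm \<eta>) * (1/2) ^ j :: real)"
  have r: "r sums (36 * norm \<xi> * norm \<eta> * 2)" unfolding r_def by (rule sums_mult[OF geo])
  have "predual_norm_le (\<lambda>x. cinner \<xi> (op_tensor tens x id \<eta>)) (\<Sum>j. r j)"
  proof (rule predual_norm_le_sums)
    show "predual_norm_le (\<lambda>x. cinner (u j) (op_tensor tens x id \<eta>)) (r j)" for j
      using mult_right_mono[OF u(3)[of j], of "6 * norm \<eta> * 2"]
      by (intro predual_norm_le_mono[OF step]) (simp add: r_def mult_ac)
    show "summable r" using r by (rule sums_summable)
    show "(\<lambda>j. cinner (u j) (op_tensor tens x id \<eta>)) sums cinner \<xi> (op_tensor tens x id \<eta>)" for x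
      by (rule bounded_linear.sums[OF bounded_bilinear.bounded_linear_left[OF bounded_bilinear_cinner] u(2)])
  qed
  then show ?thesis by (simp add: sums_unique[OF r, symmetric] mult_ac)
qed

lemma predual_amplification:
  assumes "predual_norm_le f r"
  shows "\<exists>s. predual_norm_le (\<lambda>x. f (op_tensor tens x id)) s"
proof -
  obtain \<xi> \<eta> where s: "summable (\<lambda>n. (norm (\<xi> n))\<^sup>2)" "summable (\<lambda>n. (norm (\<eta> n))\<^sup>2)"
    and "(\<Sum>n. (norm (\<xi> n))\<^sup>2) \<le> r" "(\<Sum>n. (norm (\<eta> n))\<^sup>2) \<le> r"
    and f: "\<forall>x. bounded_clinear x \<longrightarrow> f x = (\<Sum>n. cinner (\<xi> n) (x (\<eta> n)))"
    using assms by (rule predual_norm_leE)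
  \<comment> \<open>\<open>72 * (a * b) \<le> 36 * (a\<^sup>2 + b\<^sup>2)\<close>.\<close>
  define q where "q = (\<lambda>n. 36 * ((norm (\<xi> n))\<^sup>2 + (norm (\<eta> n))\<^sup>2))"
  have "predual_norm_le (\<lambda>x. f (op_tensor tens x id)) (\<Sum>n. q n)"
  proof (rule predual_norm_le_sums)
    show "predual_norm_le (\<lambda>x. cinner (\<xi> n) (op_tensor tens x id (\<eta> n))) (q n)" for n
      using sum_squares_bound[of "norm (\<xi> n)" "norm (\<eta> n)"]
      by (intro predual_norm_le_mono[OF predual_amplification_coefficient]) (simp add: q_def)
    show "summable q" unfolding q_def by (intro summable_mult summable_add s)
  next
    fix x :: "'a \<Rightarrow> 'a" assume "bounded_clinear x"
    then have z: "bounded_clinear (op_tensor tens x id)"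
      using bounded_clinear_op_tensor bounded_clinear_id by blast
    show "(\<lambda>n. cinner (\<xi> n) (op_tensor tens x id (\<eta> n))) sums f (op_tensor tens x id)"
      unfolding f[rule_format, OF z]
      by (rule summable_sums[OF summable_norm_cancel[OF summable_coefficients[OF s z]]])
  qed
  then show ?thesis by blast
qed

end

section \<open>The von Neumann algebra tensor product\<close>

context hilbert_tensor
begin

lemma vn_tensor_generators:
  assumes M: "vn_algebra M" and N: "vn_algebra N"
  defines "G \<equiv> {op_tensor tens x y | x y. x \<in> M \<and> y \<in> N}"
  shows "G \<subseteq> operators" "id \<in> G" "\<And>x y. x \<in> G \<Longrightarrow> y \<in> G \<Longrightarrow> x \<circ> y \<in> G"
    "\<And>x. x \<in> G \<Longrightarrow> op_adjoint x \<in> G"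
proof -
  have bd: "bounded_clinear x" if "x \<in> M" for x using M that by (auto simp: vn_algebra_def)
  have bd': "bounded_clinear x" if "x \<in> N" for x using N that by (auto simp: vn_algebra_def)
  show "G \<subseteq> operators" using bounded_clinear_op_tensor bd bd' by (auto simp: G_def)
  show "id \<in> G"
    unfolding G_def mem_Collect_eq
    by (rule exI[of _ id], rule exI[of _ id]) (use M N op_tensor_id in \<open>simp add: vn_algebra_def\<close>)
  show "x \<circ> y \<in> G" if xy: "x \<in> G" "y \<in> G" for x y
  proof -
    obtain a b c d where "x = op_tensor tens a b" "y = op_tensor tens c d"
      "a \<in> M" "b \<in> N" "c \<in> M" "d \<in> N" using xy unfolding G_def by blast
    moreover from this have "a \<circ> c \<in> M" "b \<circ> d \<in> N" using M N by (auto simp: vn_algebra_def)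
    ultimately show ?thesis unfolding G_def using op_tensor_comp bd bd' by blast
  qed
  show "op_adjoint x \<in> G" if x: "x \<in> G" for x
  proof -
    obtain a b where ab: "x = op_tensor tens a b" "a \<in> M" "b \<in> N" using x unfolding G_def by blast
    have "op_adjoint x = op_tensor tens (op_adjoint a) (op_adjoint b)"
      unfolding ab(1)
      by (intro op_adjoint_eqI op_tensor_adjoint bounded_clinear_op_adjoint is_adjoint_op_adjoint bd bd' ab)
    then show ?thesis
      unfolding G_def using vn_algebra_op_adjoint[OF M ab(2)] vn_algebra_op_adjoint[OF N ab(3)] by blast
  qed
qed

lemma vn_algebra_vn_tensor:
  "vn_algebra M \<Longrightarrow> vn_algebra N \<Longrightarrow> vn_algebra (vn_tensor tens M N)"
  unfolding vn_tensor_def by (rule vn_algebra_hull) (rule vn_tensor_generators)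

lemma op_tensor_in_vn_tensor: "x \<in> M \<Longrightarrow> y \<in> N \<Longrightarrow> op_tensor tens x y \<in> vn_tensor tens M N"
  unfolding vn_tensor_def by (rule hull_inc) blast

lemma vn_tensor_induct:
  assumes "vn_algebra M" "vn_algebra N" "z \<in> vn_tensor tens M N" "uw_closed_subspace L"
    and "\<And>x y. x \<in> M \<Longrightarrow> y \<in> N \<Longrightarrow> op_tensor tens x y \<in> L"
  shows "z \<in> L"
  using vn_hull_induct[OF vn_tensor_generators[OF assms(1,2)], of z L] assms(3-5)
  unfolding vn_tensor_def by blast

text \<open>
  The equaliser of two continuous functions into a Hausdorff space is closed in \<open>M \<otimes> N\<close>, which is
  itself closed in the algebra of all operators, so the induction principle applies to it.
\<close>
lemma uw_linear_functional_eqI: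
  assumes M: "vn_algebra M" and N: "vn_algebra N"
    and f: "uw_linear_functional (vn_tensor tens M N) f"
    and g: "uw_linear_functional (vn_tensor tens M N) g"
    and eq: "\<And>x y. x \<in> M \<Longrightarrow> y \<in> N \<Longrightarrow> f (op_tensor tens x y) = g (op_tensor tens x y)"
    and z: "z \<in> vn_tensor tens M N"
  shows "f z = g z"
proof -
  define A where "A = vn_tensor tens M N"
  have A: "vn_algebra A" unfolding A_def by (rule vn_algebra_vn_tensor[OF M N])
  have top: "ultraweak_topology A = subtopology (ultraweak_topology operators) A"
    using A by (intro ultraweak_subtopology) (auto simp: vn_algebra_def)
  have "closedin (ultraweak_topology A) {x \<in> topspace (ultraweak_topology A). f x = g x}"
    using f g unfolding A_def uw_linear_functional_def
    by (intro closedin_continuous_maps_eq[of euclidean]) auto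
  then have "closedin (subtopology (ultraweak_topology operators) A) {x \<in> A. f x = g x}"
    by (simp add: top[symmetric])
  then have "closedin (ultraweak_topology operators) {x \<in> A. f x = g x}"
    by (rule closedin_trans_full) (use A in \<open>simp add: vn_algebra_def\<close>)
  then have "uw_closed_subspace {x \<in> A. f x = g x}"
    using A f g by (auto simp: uw_closed_subspace_def vn_algebra_def uw_linear_functional_def A_def)
  from vn_tensor_induct[OF M N z this] show ?thesis
    using eq op_tensor_in_vn_tensor by (auto simp: A_def)
qed

end

section \<open>Normal linear maps\<close>

lemma uw_linear_map_coefficient:
  assumes "uw_linear_map A B T" "B \<subseteq> operators"
  shows "uw_linear_functional A (\<lambda>z. cinner \<alpha> (T z \<beta>))"
proof -
  have "predual_norm_le (\<lambda>x. cinner \<alpha> (x \<beta>)) (max ((norm \<alpha>)\<^sup>2) ((norm \<beta>)\<^sup>2))"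
    by (rule predual_norm_le_coefficient) auto
  then have "continuous_map (ultraweak_topology B) euclidean (\<lambda>x. cinner \<alpha> (x \<beta>))"
    by (rule continuous_map_ultraweak_functional[OF assms(2)])
  from continuous_map_compose[OF _ this, of "ultraweak_topology A" T] show ?thesis
    using assms(1)
    by (auto simp: uw_linear_map_def uw_linear_functional_def op_lincomb_def o_def
        cinner_add_right cinner_scaleC_right)
qed

lemma uw_linear_functional_comp:
  assumes T: "uw_linear_map A B T" and f: "uw_linear_functional B f"
  shows "uw_linear_functional A (\<lambda>x. f (T x))"
proof -
  have "continuous_map (ultraweak_topology A) euclidean (f \<circ> T)"
    using T f unfolding uw_linear_map_def uw_linear_functional_def
    by (blast intro: continuous_map_compose)
  then show ?thesis
    using T f by (auto simp: uw_linear_map_def uw_linear_functional_def o_def Pi_iff)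
qed

lemma uw_linear_functional_cong:
  assumes f: "uw_linear_functional A f" and eq: "\<And>x. x \<in> A \<Longrightarrow> g x = f x"
    and A: "\<And>x y a b. x \<in> A \<Longrightarrow> y \<in> A \<Longrightarrow> op_lincomb a x b y \<in> A"
  shows "uw_linear_functional A g"
proof -
  have "continuous_map (ultraweak_topology A) euclidean g"
    using f unfolding uw_linear_functional_def by (intro continuous_map_eq[of _ _ f g]) (auto simp: eq)
  then show ?thesis using f A by (auto simp: uw_linear_functional_def eq)
qed

lemma normal_ucp_comp:
  assumes T: "normal_ucp A B T" and S: "normal_ucp B C S"
  shows "normal_ucp A C (\<lambda>x. S (T x))"
  unfolding normal_ucp_def uw_linear_map_def
proof (intro conjI ballI allI)
  have TB: "T x \<in> B" if "x \<in> A" for x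
    using T that by (auto simp: normal_ucp_def uw_linear_map_def)
  show "(\<lambda>x. S (T x)) \<in> A \<rightarrow> C"
    using TB S by (auto simp: normal_ucp_def uw_linear_map_def)
  show "S (T (op_lincomb a x b y)) = op_lincomb a (S (T x)) b (S (T y))" if "x \<in> A" "y \<in> A" for x y a b
    using TB T S that by (simp add: normal_ucp_def uw_linear_map_def)
  have "continuous_map (ultraweak_topology A) (ultraweak_topology C) (S \<circ> T)"
    using T S unfolding normal_ucp_def uw_linear_map_def by (blast intro: continuous_map_compose)
  then show "continuous_map (ultraweak_topology A) (ultraweak_topology C) (\<lambda>x. S (T x))"
    by (simp add: o_def)
  show "S (T id) = id" using T S by (simp add: normal_ucp_def)
  show "completely_positive A (\<lambda>x. S (T x))"
    unfolding completely_positive_def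
  proof (intro allI impI)
    fix n x assume x: "\<forall>i<n. \<forall>j<n. x i j \<in> A" and pos: "positive_op_matrix n x"
    have "positive_op_matrix n (\<lambda>i j. T (x i j))"
      using T x pos unfolding normal_ucp_def completely_positive_def by blast
    moreover have "\<forall>i<n. \<forall>j<n. T (x i j) \<in> B" using x TB by blast
    ultimately show "positive_op_matrix n (\<lambda>i j. S (T (x i j)))"
      using S[unfolded normal_ucp_def completely_positive_def, THEN conjunct2, THEN conjunct2,
          rule_format, of n "\<lambda>i j. T (x i j)"] by blast
  qed
qed

lemma (in hilbert_tensor) normal_ucp_amplification:
  assumes M: "vn_algebra M" and N: "vn_algebra N"
  shows "normal_ucp M (vn_tensor tens M N) (\<lambda>x. op_tensor tens x id)"
  unfolding normal_ucp_def uw_linear_map_def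
proof (intro conjI ballI allI)
  have bd: "M \<subseteq> operators" and idN: "id \<in> N" using M N by (auto simp: vn_algebra_def)
  show into: "(\<lambda>x. op_tensor tens x id) \<in> M \<rightarrow> vn_tensor tens M N"
    using op_tensor_in_vn_tensor idN by auto
  show "op_tensor tens (op_lincomb a x b y) id =
      op_lincomb a (op_tensor tens x id) b (op_tensor tens y id)" if "x \<in> M" "y \<in> M" for x y a b
    using that bd by (intro op_tensor_lincomb_left bounded_clinear_id) auto
  show "continuous_map (ultraweak_topology M) (ultraweak_topology (vn_tensor tens M N))
      (\<lambda>x. op_tensor tens x id)"
  proof (rule continuous_map_into_ultraweak)
    show "(\<lambda>x. op_tensor tens x id) \<in> topspace (ultraweak_topology M) \<rightarrow> vn_tensor tens M N"
      using into by simp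
    fix f :: "('k \<Rightarrow> 'k) \<Rightarrow> complex" and r assume "predual_norm_le f r"
    from predual_amplification[OF this] obtain s
      where "predual_norm_le (\<lambda>x. f (op_tensor tens x id)) s" ..
    then show "continuous_map (ultraweak_topology M) euclidean (\<lambda>x. f (op_tensor tens x id))"
      by (rule continuous_map_ultraweak_functional[OF bd])
  qed
  show "op_tensor tens id id = id" by (rule op_tensor_id)
  show "completely_positive M (\<lambda>x. op_tensor tens x id)"
    unfolding completely_positive_def
    using positive_op_matrix_amplification bd by blast
qed

section \<open>Slice maps and product states\<close>

context hilbert_tensor
begin

text \<open>
  For \<open>f = (\<Sum>n. \<langle>\<xi> n, \<cdot> \<eta> n\<rangle>)\<close> the slice \<open>S z\<close> has the matrix coefficients
  \<open>B z \<alpha> \<beta> = (\<Sum>n. \<langle>\<alpha> \<otimes> \<xi> n, z (\<beta> \<otimes> \<eta> n)\<rangle>)\<close>. For fixed \<open>\<alpha>\<close> and \<open>\<beta>\<close> these are normal functionals of \<open>z\<close>, with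
  predual norms that are summable along square summable \<open>\<alpha>\<close> and \<open>\<beta>\<close>; hence \<open>S\<close> is normal.
\<close>
lemma slice_operator:
  assumes "predual_norm_le f r"
  shows "\<exists>S. (\<forall>z. bounded_clinear z \<longrightarrow> bounded_clinear (S z)) \<and>
    (\<forall>z w a b. bounded_clinear z \<longrightarrow> bounded_clinear w \<longrightarrow>
       S (op_lincomb a z b w) = op_lincomb a (S z) b (S w)) \<and>
    (\<forall>x y. bounded_clinear x \<longrightarrow> bounded_clinear y \<longrightarrow>
       S (op_tensor tens x y) = (\<lambda>\<xi>. f y *\<^sub>C x \<xi>)) \<and>
    (\<forall>g s. predual_norm_le g s \<longrightarrow> (\<exists>t. predual_norm_le (\<lambda>z. g (S z)) t))"
proof -
  obtain \<xi> \<eta> where s: "summable (\<lambda>n. (norm (\<xi> n))\<^sup>2)" "summable (\<lambda>n. (norm (\<eta> n))\<^sup>2)"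
    and le: "(\<Sum>n. (norm (\<xi> n))\<^sup>2) \<le> r" "(\<Sum>n. (norm (\<eta> n))\<^sup>2) \<le> r"
    and f: "\<forall>x. bounded_clinear x \<longrightarrow> f x = (\<Sum>n. cinner (\<xi> n) (x (\<eta> n)))"
    using assms by (rule predual_norm_leE)
  define B where "B = (\<lambda>z \<alpha> \<beta>. \<Sum>n. cinner (tens \<alpha> (\<xi> n)) (z (tens \<beta> (\<eta> n))))"
  have sq: "summable (\<lambda>n. (norm (tens \<alpha> (\<zeta> n)))\<^sup>2)" if "summable (\<lambda>n. (norm (\<zeta> n))\<^sup>2)" for \<alpha> \<zeta>
    unfolding norm_tens power_mult_distrib by (rule summable_mult[OF that])
  have B: "(\<lambda>n. cinner (tens \<alpha> (\<xi> n)) (z (tens \<beta> (\<eta> n)))) sums B z \<alpha> \<beta>"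
    if "bounded_clinear z" for z \<alpha> \<beta>
    unfolding B_def
    by (rule summable_sums[OF summable_norm_cancel[OF summable_coefficients[OF sq[OF s(1)] sq[OF s(2)] that]]])
  have riesz: "\<exists>T. bounded_clinear T \<and> (\<forall>\<alpha> \<beta>. cinner \<alpha> (T \<beta>) = B z \<alpha> \<beta>)"
    if z: "bounded_clinear z" for z
  proof -
    obtain K where K: "K \<ge> 0" "\<And>u. norm (z u) \<le> K * norm u"
      using bounded_clinear_bound[OF z] by blast
    define c where "c = (\<Sum>n. (norm (\<xi> n))\<^sup>2 + (norm (\<eta> n))\<^sup>2)"
    have sc: "summable (\<lambda>n. (norm (\<xi> n))\<^sup>2 + (norm (\<eta> n))\<^sup>2)" by (rule summable_add[OF s])
    show ?thesis
    proof (rule riesz_sesquilinear)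
      fix \<alpha> \<alpha>' \<beta> \<beta>' and a :: complex
      show "B z (\<alpha> + \<alpha>') \<beta> = B z \<alpha> \<beta> + B z \<alpha>' \<beta>"
        using B[OF z, of "\<alpha> + \<alpha>'" \<beta>] sums_add[OF B[OF z, of \<alpha> \<beta>] B[OF z, of \<alpha>' \<beta>]]
        by (simp add: tens_add_left cinner_add_left sums_iff)
      show "B z (a *\<^sub>C \<alpha>) \<beta> = cnj a * B z \<alpha> \<beta>"
        using B[OF z, of "a *\<^sub>C \<alpha>" \<beta>] sums_mult[OF B[OF z, of \<alpha> \<beta>], of "cnj a"]
        by (simp add: tens_scaleC_left cinner_scaleC_left sums_iff)
      show "B z \<alpha> (\<beta> + \<beta>') = B z \<alpha> \<beta> + B z \<alpha> \<beta>'"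
        using B[OF z, of \<alpha> "\<beta> + \<beta>'"] sums_add[OF B[OF z, of \<alpha> \<beta>] B[OF z, of \<alpha> \<beta>']]
        by (simp add: tens_add_left bounded_clinear_add[OF z] cinner_add_right sums_iff)
      show "B z \<alpha> (a *\<^sub>C \<beta>) = a * B z \<alpha> \<beta>"
        using B[OF z, of \<alpha> "a *\<^sub>C \<beta>"] sums_mult[OF B[OF z, of \<alpha> \<beta>], of a]
        by (simp add: tens_scaleC_left bounded_clinear_scaleC[OF z] cinner_scaleC_right sums_iff)
      show "K * c \<ge> 0"
        unfolding c_def using K(1) suminf_nonneg[OF sc] by simp
      have "cmod (B z \<alpha> \<beta>) \<le> (\<Sum>n. K * norm \<alpha> * norm \<beta> * ((norm (\<xi> n))\<^sup>2 + (norm (\<eta> n))\<^sup>2))"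
        unfolding B_def
      proof (rule norm_suminf_le)
        show "summable (\<lambda>n. K * norm \<alpha> * norm \<beta> * ((norm (\<xi> n))\<^sup>2 + (norm (\<eta> n))\<^sup>2))"
          by (rule summable_mult[OF sc])
        fix n
        have "2 * (norm (\<xi> n) * norm (\<eta> n)) \<le> (norm (\<xi> n))\<^sup>2 + (norm (\<eta> n))\<^sup>2"
          using sum_squares_bound[of "norm (\<xi> n)" "norm (\<eta> n)"] by simp
        then have *: "norm (\<xi> n) * norm (\<eta> n) \<le> (norm (\<xi> n))\<^sup>2 + (norm (\<eta> n))\<^sup>2"
          using mult_nonneg_nonneg[OF norm_ge_zero[of "\<xi> n"] norm_ge_zero[of "\<eta> n"]] by linarith
        have "cmod (cinner (tens \<alpha> (\<xi> n)) (z (tens \<beta> (\<eta> n)))) \<le>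
            norm (tens \<alpha> (\<xi> n)) * (K * norm (tens \<beta> (\<eta> n)))"
          by (rule order_trans[OF norm_cinner_le mult_left_mono[OF K(2)]]) simp
        also have "\<dots> = K * norm \<alpha> * norm \<beta> * (norm (\<xi> n) * norm (\<eta> n))"
          by (simp add: norm_tens mult_ac)
        also have "\<dots> \<le> K * norm \<alpha> * norm \<beta> * ((norm (\<xi> n))\<^sup>2 + (norm (\<eta> n))\<^sup>2)"
          by (rule mult_left_mono[OF *]) (use K(1) in simp)
        finally show "cmod (cinner (tens \<alpha> (\<xi> n)) (z (tens \<beta> (\<eta> n)))) \<le>
            K * norm \<alpha> * norm \<beta> * ((norm (\<xi> n))\<^sup>2 + (norm (\<eta> n))\<^sup>2)" .
      qed
      also have "\<dots> = K * norm \<alpha> * norm \<beta> * c"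
        unfolding c_def by (rule suminf_mult[OF sc])
      finally show "cmod (B z \<alpha> \<beta>) \<le> K * c * norm \<alpha> * norm \<beta>" by (simp add: mult_ac)
    qed
  qed
  have "\<forall>z\<in>operators. \<exists>T. bounded_clinear T \<and> (\<forall>\<alpha> \<beta>. cinner \<alpha> (T \<beta>) = B z \<alpha> \<beta>)"
    using riesz by simp
  from bchoice[OF this] obtain S where
    "\<forall>z\<in>operators. bounded_clinear (S z) \<and> (\<forall>\<alpha> \<beta>. cinner \<alpha> (S z \<beta>) = B z \<alpha> \<beta>)" ..
  then have bdS: "\<And>z. bounded_clinear z \<Longrightarrow> bounded_clinear (S z)"
    and S: "\<And>z \<alpha> \<beta>. bounded_clinear z \<Longrightarrow> cinner \<alpha> (S z \<beta>) = B z \<alpha> \<beta>" by simp_all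
  have lin: "S (op_lincomb a z b w) = op_lincomb a (S z) b (S w)"
    if "bounded_clinear z" "bounded_clinear w" for z w a b
  proof (rule ext, rule cinner_ext)
    fix \<alpha> \<beta>
    have zw: "bounded_clinear (op_lincomb a z b w)" by (rule bounded_clinear_lincomb[OF that])
    have "B (op_lincomb a z b w) \<alpha> \<beta> = a * B z \<alpha> \<beta> + b * B w \<alpha> \<beta>"
      using B[OF zw, of \<alpha> \<beta>]
        sums_add[OF sums_mult[OF B[OF that(1), of \<alpha> \<beta>], of a] sums_mult[OF B[OF that(2), of \<alpha> \<beta>], of b]]
      by (simp add: op_lincomb_def cinner_add_right cinner_scaleC_right sums_iff)
    then have "cinner \<alpha> (S (op_lincomb a z b w) \<beta>) = a * B z \<alpha> \<beta> + b * B w \<alpha> \<beta>"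
      using S[OF zw] by simp
    also have "\<dots> = cinner \<alpha> (op_lincomb a (S z) b (S w) \<beta>)"
      by (simp add: S that op_lincomb_def cinner_add_right cinner_scaleC_right)
    finally show "cinner \<alpha> (S (op_lincomb a z b w) \<beta>) = cinner \<alpha> (op_lincomb a (S z) b (S w) \<beta>)" .
  qed
  have tens: "S (op_tensor tens x y) = (\<lambda>\<xi>. f y *\<^sub>C x \<xi>)"
    if xy: "bounded_clinear x" "bounded_clinear y" for x y
  proof (rule ext, rule cinner_ext)
    fix \<alpha> \<beta>
    have z: "bounded_clinear (op_tensor tens x y)" by (rule bounded_clinear_op_tensor[OF xy])
    have "(\<lambda>n. cinner (\<xi> n) (y (\<eta> n))) sums f y"
      unfolding f[rule_format, OF xy(2)]
      by (rule summable_sums[OF summable_norm_cancel[OF summable_coefficients[OF s xy(2)]]])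
    from sums_mult[OF this, of "cinner \<alpha> (x \<beta>)"] B[OF z, of \<alpha> \<beta>]
    have "B (op_tensor tens x y) \<alpha> \<beta> = cinner \<alpha> (x \<beta>) * f y"
      by (simp add: op_tensor_apply[OF xy] cinner_tens sums_iff)
    then show "cinner \<alpha> (S (op_tensor tens x y) \<beta>) = cinner \<alpha> (f y *\<^sub>C x \<beta>)"
      by (simp add: S z cinner_scaleC_right)
  qed
  have normal: "\<exists>t. predual_norm_le (\<lambda>z. g (S z)) t" if g: "predual_norm_le g s'" for g s'
  proof -
    obtain \<alpha> \<beta> where ab: "summable (\<lambda>n. (norm (\<alpha> n))\<^sup>2)" "summable (\<lambda>n. (norm (\<beta> n))\<^sup>2)"
      and "(\<Sum>n. (norm (\<alpha> n))\<^sup>2) \<le> s'" "(\<Sum>n. (norm (\<beta> n))\<^sup>2) \<le> s'"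
      and geq: "\<forall>x. bounded_clinear x \<longrightarrow> g x = (\<Sum>n. cinner (\<alpha> n) (x (\<beta> n)))"
      using g by (rule predual_norm_leE)
    define q where "q = (\<lambda>m. ((norm (\<alpha> m))\<^sup>2 + (norm (\<beta> m))\<^sup>2) * r)"
    have r0: "0 \<le> r" using suminf_nonneg[OF s(1)] le(1) by simp
    have "predual_norm_le (\<lambda>z. g (S z)) (\<Sum>m. q m)"
    proof (rule predual_norm_le_sums)
      fix m
      have bound: "(\<Sum>n. (norm (tens u (\<zeta> n)))\<^sup>2) \<le> q m"
        if "summable (\<lambda>n. (norm (\<zeta> n))\<^sup>2)" "(\<Sum>n. (norm (\<zeta> n))\<^sup>2) \<le> r"
          "(norm u)\<^sup>2 \<le> (norm (\<alpha> m))\<^sup>2 + (norm (\<beta> m))\<^sup>2" for u \<zeta>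
      proof -
        have "(\<Sum>n. (norm (tens u (\<zeta> n)))\<^sup>2) = (norm u)\<^sup>2 * (\<Sum>n. (norm (\<zeta> n))\<^sup>2)"
          using suminf_mult[OF that(1)] by (simp add: norm_tens power_mult_distrib)
        also have "\<dots> \<le> (norm u)\<^sup>2 * r" by (rule mult_left_mono[OF that(2)]) simp
        also have "\<dots> \<le> q m" unfolding q_def by (rule mult_right_mono[OF that(3) r0])
        finally show ?thesis .
      qed
      show "predual_norm_le (\<lambda>z. B z (\<alpha> m) (\<beta> m)) (q m)"
        by (rule predual_norm_leI[OF sq[OF s(1)] sq[OF s(2)]])
          (auto intro!: bound s le simp: B_def)
    next
      show "summable q" unfolding q_def by (intro summable_mult2 summable_add ab)
    next
      fix z :: "'k \<Rightarrow> 'k" assume z: "bounded_clinear z"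
      have "(\<lambda>m. cinner (\<alpha> m) (S z (\<beta> m))) sums g (S z)"
        unfolding geq[rule_format, OF bdS[OF z]]
        by (rule summable_sums[OF summable_norm_cancel[OF summable_coefficients[OF ab bdS[OF z]]]])
      then show "(\<lambda>m. B z (\<alpha> m) (\<beta> m)) sums g (S z)" by (simp add: S z)
    qed
    then show ?thesis by blast
  qed
  show ?thesis using bdS lin tens normal by (intro exI[of _ S]) simp
qed

text \<open>
  The slice map is first constructed on all operators, from a normal extension of \<open>\<phi>\<close>. It maps \<open>M \<otimes> N\<close> into
  \<open>M\<close> because it does so on elementary tensors and the preimage of \<open>M\<close> is an ultraweakly closed
  subspace.
\<close>
lemma ex1_slice_map:
  assumes M: "vn_algebra M" and N: "vn_algebra N" and \<phi>: "uw_linear_functional N \<phi>"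
  shows "\<exists>!E. E \<in> extensional (vn_tensor tens M N) \<and> uw_linear_map (vn_tensor tens M N) M E \<and>
    (\<forall>a\<in>M. \<forall>b\<in>N. E (op_tensor tens a b) = (\<lambda>\<xi>. \<phi> b *\<^sub>C a \<xi>))"
proof -
  define A where "A = vn_tensor tens M N"
  have vnA: "vn_algebra A" unfolding A_def by (rule vn_algebra_vn_tensor[OF M N])
  have bdA: "A \<subseteq> operators" and bdM: "M \<subseteq> operators" and bdN: "N \<subseteq> operators"
    using vnA M N by (auto simp: vn_algebra_def)
  have "N \<noteq> {}" using N by (auto simp: vn_algebra_def)
  then have "\<exists>f r. predual_norm_le f r \<and> (\<forall>x\<in>N. \<phi> x = f x)"
    using N by (intro uw_linear_functional_extend[OF bdN _ _ \<phi>]) (auto simp: vn_algebra_def)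
  then obtain f r where f: "predual_norm_le f r" "\<And>x. x \<in> N \<Longrightarrow> \<phi> x = f x" by blast
  obtain S where bdS: "\<forall>z. bounded_clinear z \<longrightarrow> bounded_clinear (S z)"
    and lin: "\<forall>z w a b. bounded_clinear z \<longrightarrow> bounded_clinear w \<longrightarrow>
       S (op_lincomb a z b w) = op_lincomb a (S z) b (S w)"
    and St: "\<forall>x y. bounded_clinear x \<longrightarrow> bounded_clinear y \<longrightarrow>
       S (op_tensor tens x y) = (\<lambda>\<xi>. f y *\<^sub>C x \<xi>)"
    and normal: "\<forall>g s. predual_norm_le g s \<longrightarrow> (\<exists>t. predual_norm_le (\<lambda>z. g (S z)) t)"
    using slice_operator[OF f(1)] by (elim exE conjE)
  have gen: "S (op_tensor tens a b) = (\<lambda>\<xi>. \<phi> b *\<^sub>C a \<xi>)" if "a \<in> M" "b \<in> N" for a b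
    using St that bdM bdN f(2) by auto
  have SM: "S z \<in> M" if z: "z \<in> A" for z
  proof -
    have cont: "continuous_map (ultraweak_topology operators) (ultraweak_topology operators) S"
      by (rule continuous_map_operators) (use bdS normal in auto)
    have "z \<in> {z \<in> operators. S z \<in> M}"
    proof (rule vn_tensor_induct[OF M N z[unfolded A_def]])
      show "uw_closed_subspace {z \<in> operators. S z \<in> M}"
        by (rule uw_closed_subspace_vimage[OF vn_algebra_imp_uw_closed_subspace[OF M] cont,
              where \<sigma> = "\<lambda>a. a"]) (use lin in auto)
    next
      fix a b assume ab: "a \<in> M" "b \<in> N"
      have "(\<lambda>\<xi>. \<phi> b *\<^sub>C a \<xi>) = op_lincomb (\<phi> b) a 0 a" by (simp add: op_lincomb_def)
      also have "\<dots> \<in> M" using M ab by (auto simp: vn_algebra_def)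
      finally show "op_tensor tens a b \<in> {z \<in> operators. S z \<in> M}"
        using ab bdA op_tensor_in_vn_tensor[OF ab] by (auto simp: gen A_def)
    qed
    then show ?thesis by simp
  qed
  have map: "uw_linear_map A M (restrict S A)"
    unfolding uw_linear_map_def
  proof (intro conjI ballI allI)
    show "restrict S A \<in> A \<rightarrow> M" using SM by auto
    show "restrict S A (op_lincomb a x b y) = op_lincomb a (restrict S A x) b (restrict S A y)"
      if "x \<in> A" "y \<in> A" for x y a b
      using that vnA lin bdA by (auto simp: vn_algebra_def subset_iff)
    have "continuous_map (ultraweak_topology A) (ultraweak_topology M) S"
    proof (rule continuous_map_into_ultraweak)
      show "S \<in> topspace (ultraweak_topology A) \<rightarrow> M" using SM by auto
      fix g :: "('a \<Rightarrow> 'a) \<Rightarrow> complex" and s assume "predual_norm_le g s"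
      then obtain t where "predual_norm_le (\<lambda>z. g (S z)) t" using normal by blast
      then show "continuous_map (ultraweak_topology A) euclidean (\<lambda>z. g (S z))"
        by (rule continuous_map_ultraweak_functional[OF bdA])
    qed
    then show "continuous_map (ultraweak_topology A) (ultraweak_topology M) (restrict S A)"
      by (rule continuous_map_eq) simp
  qed
  show ?thesis
    unfolding A_def[symmetric]
  proof (rule ex1I[of _ "restrict S A"])
    show "restrict S A \<in> extensional A \<and> uw_linear_map A M (restrict S A) \<and>
        (\<forall>a\<in>M. \<forall>b\<in>N. restrict S A (op_tensor tens a b) = (\<lambda>\<xi>. \<phi> b *\<^sub>C a \<xi>))"
      using map gen op_tensor_in_vn_tensor by (simp add: A_def)
  next
    fix E assume E: "E \<in> extensional A \<and> uw_linear_map A M E \<and>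
        (\<forall>a\<in>M. \<forall>b\<in>N. E (op_tensor tens a b) = (\<lambda>\<xi>. \<phi> b *\<^sub>C a \<xi>))"
    show "E = restrict S A"
    proof (rule extensionalityI[of _ A])
      fix z assume z: "z \<in> A"
      show "E z = restrict S A z"
      proof (rule ext, rule cinner_ext)
        fix \<beta> \<alpha>
        show "cinner \<alpha> (E z \<beta>) = cinner \<alpha> (restrict S A z \<beta>)"
        proof (rule uw_linear_functional_eqI[OF M N _ _ _ z[unfolded A_def]])
          show "uw_linear_functional (vn_tensor tens M N) (\<lambda>z. cinner \<alpha> (E z \<beta>))"
            using E uw_linear_map_coefficient[OF _ bdM] unfolding A_def by blast
          show "uw_linear_functional (vn_tensor tens M N) (\<lambda>z. cinner \<alpha> (restrict S A z \<beta>))"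
            using uw_linear_map_coefficient[OF map bdM] unfolding A_def .
          show "cinner \<alpha> (E (op_tensor tens x y) \<beta>) = cinner \<alpha> (restrict S A (op_tensor tens x y) \<beta>)"
            if "x \<in> M" "y \<in> N" for x y
            using that E gen op_tensor_in_vn_tensor[OF that] by (simp add: A_def)
        qed
      qed
    qed (use E in auto)
  qed
qed

end

lemma slice_map_props:
  fixes tens :: "'a::chilbert_space \<Rightarrow> 'a \<Rightarrow> 'k::chilbert_space"
  assumes "hilbert_tensor tens" "vn_algebra M" "uw_linear_functional M \<phi>"
  shows uw_linear_slice_map: "uw_linear_map (vn_tensor tens M M) M (slice_map tens M \<phi>)"
    and slice_map_op_tensor: "\<And>a b. a \<in> M \<Longrightarrow> b \<in> M \<Longrightarrow>
      slice_map tens M \<phi> (op_tensor tens a b) = (\<lambda>\<xi>. \<phi> b *\<^sub>C a \<xi>)"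
  using theI'[OF hilbert_tensor.ex1_slice_map[OF assms(1,2,2,3)]]
  unfolding slice_map_def[symmetric] by blast+

lemma slice_map_cong:
  assumes "\<And>x. x \<in> M \<Longrightarrow> \<phi> x = \<psi> x"
  shows "slice_map tens M \<phi> = slice_map tens M \<psi>"
  unfolding slice_map_def using assms by (simp cong: ball_cong)

lemma map_tensor_cong:
  assumes "\<And>x. x \<in> M \<Longrightarrow> T x = T' x"
  shows "map_tensor tens M T = map_tensor tens M T'"
  unfolding map_tensor_def using assms by (simp cong: ball_cong)

text \<open>
  Both sides are ultraweakly continuous and agree on elementary tensors. This also constructs the product
  functional \<open>\<phi> \<otimes> \<phi>\<close>.
\<close>
lemma state_tensor_eq_slice:
  fixes tens :: "'a::chilbert_space \<Rightarrow> 'a \<Rightarrow> 'k::chilbert_space"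
  assumes t: "hilbert_tensor tens" and M: "vn_algebra M" and \<phi>: "uw_linear_functional M \<phi>"
    and z: "z \<in> vn_tensor tens M M"
  shows "state_tensor tens M \<phi> z = \<phi> (slice_map tens M \<phi> z)"
proof -
  interpret hilbert_tensor tens by fact
  define A where "A = vn_tensor tens M M"
  define f where "f = restrict (\<lambda>z. \<phi> (slice_map tens M \<phi> z)) A"
  have vnA: "vn_algebra A" unfolding A_def by (rule vn_algebra_vn_tensor[OF M M])
  have "uw_linear_functional A (\<lambda>z. \<phi> (slice_map tens M \<phi> z))"
    unfolding A_def by (rule uw_linear_functional_comp[OF uw_linear_slice_map[OF t M \<phi>] \<phi>])
  then have lin: "uw_linear_functional A f"
    by (rule uw_linear_functional_cong) (use vnA in \<open>auto simp: f_def vn_algebra_def\<close>)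
  have gen: "f (op_tensor tens x y) = \<phi> x * \<phi> y" if xy: "x \<in> M" "y \<in> M" for x y
  proof -
    have "slice_map tens M \<phi> (op_tensor tens x y) = op_lincomb (\<phi> y) x 0 x"
      by (simp add: slice_map_op_tensor[OF t M \<phi> xy] op_lincomb_def)
    moreover have "\<phi> (op_lincomb (\<phi> y) x 0 x) = \<phi> y * \<phi> x + 0 * \<phi> x"
      using \<phi> xy unfolding uw_linear_functional_def by blast
    ultimately show ?thesis
      using op_tensor_in_vn_tensor[OF xy] by (simp add: f_def A_def)
  qed
  have "state_tensor tens M \<phi> = f"
    unfolding state_tensor_def A_def[symmetric]
  proof (rule the_equality)
    show "f \<in> extensional A \<and> uw_linear_functional A f \<and>
        (\<forall>x\<in>M. \<forall>y\<in>M. f (op_tensor tens x y) = \<phi> x * \<phi> y)"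
      using lin gen by (simp add: f_def)
  next
    fix g assume g: "g \<in> extensional A \<and> uw_linear_functional A g \<and>
        (\<forall>x\<in>M. \<forall>y\<in>M. g (op_tensor tens x y) = \<phi> x * \<phi> y)"
    show "g = f"
    proof (rule extensionalityI[of _ A])
      show "g z = f z" if "z \<in> A" for z
        using that g lin gen uw_linear_functional_eqI[OF M M, of g f z] by (simp add: A_def)
    qed (use g in \<open>auto simp: f_def\<close>)
  qed
  then show ?thesis using z by (simp add: f_def A_def)
qed

section \<open>The quadratic process of a Markov process\<close>

theorem theorem3p6:
  fixes tens :: "'a::chilbert_space \<Rightarrow> 'a \<Rightarrow> 'k::chilbert_space"
    and M :: "('a \<Rightarrow> 'a) set"
    and \<omega>\<^sub>0 :: "('a \<Rightarrow> 'a) \<Rightarrow> complex"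
    and Q :: "real \<Rightarrow> real \<Rightarrow> ('a \<Rightarrow> 'a) \<Rightarrow> 'a \<Rightarrow> 'a"
    and h :: "real \<Rightarrow> real \<Rightarrow> ('k \<Rightarrow> 'k) \<Rightarrow> 'k \<Rightarrow> 'k"
    and \<phi> \<psi> :: "real \<Rightarrow> ('a \<Rightarrow> 'a) \<Rightarrow> complex"
  assumes "hilbert_tensor tens"
    and "vn_algebra M"
    and "normal_state M \<omega>\<^sub>0"
    and "markov_process M Q"
    and "\<And>s t. 0 \<le> s \<Longrightarrow> 1 \<le> t - s \<Longrightarrow>
           normal_ucp (vn_tensor tens M M) (vn_tensor tens M M) (h s t)"
    and "\<phi> 0 = \<omega>\<^sub>0" and "\<psi> 0 = \<omega>\<^sub>0"
    and "\<And>t x. 1 \<le> t \<Longrightarrow> x \<in> M \<Longrightarrow> \<phi> t x = \<omega>\<^sub>0 (Q 0 t x)"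
    and "\<And>t x. 1 \<le> t \<Longrightarrow> x \<in> M \<Longrightarrow>
           \<psi> t x = state_tensor tens M \<omega>\<^sub>0 (h 0 t (op_tensor tens x id))"
    and "\<And>s t x. 0 \<le> s \<Longrightarrow> 1 \<le> t - s \<Longrightarrow> x \<in> vn_tensor tens M M \<Longrightarrow>
           flip tens M (h s t x) = h s t x"
    and "\<And>s t x. s \<in> {0} \<union> {1..} \<Longrightarrow> 1 \<le> t - s \<Longrightarrow> x \<in> vn_tensor tens M M \<Longrightarrow>
           slice_map tens M (\<psi> s) (h s t x) = Q s t (slice_map tens M (\<phi> t) x)"
    and "\<And>s t x. 0 \<le> s \<Longrightarrow> 1 \<le> t - s \<Longrightarrow> x \<in> vn_tensor tens M M \<Longrightarrow>
           h s t x = h s t (op_tensor tens (slice_map tens M (\<psi> t) x) id)"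
    and "\<And>s \<tau> t x. 0 \<le> s \<Longrightarrow> 1 \<le> \<tau> - s \<Longrightarrow> 1 \<le> t - \<tau> \<Longrightarrow> x \<in> vn_tensor tens M M \<Longrightarrow>
           h s t x = map_tensor tens M (Q s \<tau>) (h \<tau> t x)"
  shows "(\<forall>t\<in>{0} \<union> {1..}. \<forall>x\<in>M. \<phi> t x = \<psi> t x) \<and>
    qqsp_type_B tens M (\<lambda>s t x. h s t (op_tensor tens x id)) \<omega>\<^sub>0 \<and>
    (\<forall>s\<in>{0} \<union> {1..}. \<forall>t. 1 \<le> t - s \<longrightarrow>
       (\<forall>x\<in>M. Q s t x = slice_map tens M (\<phi> s) (h s t (op_tensor tens x id))))"
proof -
  note tens = assms(1) and M = assms(2) and \<omega> = assms(3) and Q = assms(4) and h = assms(5)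
    and \<phi>0 = assms(6) and \<psi>0 = assms(7) and \<phi> = assms(8) and \<psi> = assms(9)
    and flip = assms(10) and condition_ii = assms(11) and evolution = assms(13)
  interpret hilbert_tensor tens by (rule tens)
  define N where "N = vn_tensor tens M M"
  define P where "P = (\<lambda>s t x. h s t (op_tensor tens x id))"
  have idM: "id \<in> M" and lincombM: "\<And>x y a b. x \<in> M \<Longrightarrow> y \<in> M \<Longrightarrow> op_lincomb a x b y \<in> M"
    using M by (auto simp: vn_algebra_def)
  have amp: "op_tensor tens x id \<in> N" if "x \<in> M" for x
    unfolding N_def using that idM by (rule op_tensor_in_vn_tensor)
  have hN: "h s t z \<in> N" if "0 \<le> s" "1 \<le> t - s" "z \<in> N" for s t z
    using h[OF that(1,2)] that(3) by (auto simp: N_def normal_ucp_def uw_linear_map_def)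
  have QM: "normal_ucp M M (Q s t)" if "0 \<le> s" "1 \<le> t - s" for s t
    using Q that by (simp add: markov_process_def)
  have \<omega>_lin: "uw_linear_functional M \<omega>\<^sub>0" and \<omega>_id: "\<omega>\<^sub>0 id = 1"
    using \<omega> by (auto simp: normal_state_def)
  have \<phi>_lin: "uw_linear_functional M (\<phi> t)" and \<phi>_id: "\<phi> t id = 1" if t: "1 \<le> t" for t
  proof -
    have ucp: "normal_ucp M M (Q 0 t)" using QM t by simp
    then have "uw_linear_functional M (\<lambda>x. \<omega>\<^sub>0 (Q 0 t x))"
      using uw_linear_functional_comp[of M M "Q 0 t" \<omega>\<^sub>0] \<omega>_lin by (simp add: normal_ucp_def)
    then show "uw_linear_functional M (\<phi> t)"
      by (rule uw_linear_functional_cong) (use \<phi> t lincombM in auto)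
    show "\<phi> t id = 1" using \<phi>[OF t idM] ucp \<omega>_id by (simp add: normal_ucp_def)
  qed
  have slice_amp: "slice_map tens M (\<phi> t) (op_tensor tens x id) = x" if "1 \<le> t" "x \<in> M" for t x
    using slice_map_op_tensor[OF tens M \<phi>_lin[OF that(1)] that(2) idM] \<phi>_id[OF that(1)] by simp
  \<comment> \<open>The key identity: slicing \<open>P\<close> by the state at the initial time gives back \<open>Q\<close>.\<close>
  have slice_P: "slice_map tens M (\<psi> s) (P s t x) = Q s t x"
    if "s \<in> {0} \<union> {1..}" "1 \<le> t - s" "x \<in> M" for s t x
    using condition_ii[OF that(1,2) amp[OF that(3), unfolded N_def]] slice_amp[of t x] that
    by (auto simp: P_def)
  have \<phi>\<psi>: "\<phi> t x = \<psi> t x" if "t \<in> {0} \<union> {1..}" "x \<in> M" for t x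
  proof (cases "t = 0")
    case True
    then show ?thesis by (simp add: \<phi>0 \<psi>0)
  next
    case False
    then have t: "1 \<le> t" using that(1) by auto
    have "P 0 t x \<in> N" unfolding P_def using hN amp t that(2) by simp
    then have "\<psi> t x = \<omega>\<^sub>0 (slice_map tens M \<omega>\<^sub>0 (P 0 t x))"
      using \<psi>[OF t that(2)] state_tensor_eq_slice[OF tens M \<omega>_lin] by (simp add: P_def N_def)
    also have "\<dots> = \<omega>\<^sub>0 (Q 0 t x)" using slice_P[of 0 t x] t that(2) \<psi>0 by simp
    finally show ?thesis using \<phi>[OF t that(2)] by simp
  qed
  have state: "slice_map tens M (qqsp_state tens M P \<omega>\<^sub>0 s) = slice_map tens M (\<psi> s)"
    if "s \<in> {0} \<union> {1..}" for s :: real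
    using that \<psi> \<psi>0 by (intro slice_map_cong) (auto simp: qqsp_state_def P_def)
  have "qqsp_type_B tens M P \<omega>\<^sub>0"
    unfolding qqsp_type_B_def
  proof (intro conjI allI impI ballI \<omega>)
    fix s t :: real assume st: "0 \<le> s" "1 \<le> t - s"
    show "normal_ucp M (vn_tensor tens M M) (P s t)"
      unfolding P_def by (rule normal_ucp_comp[OF normal_ucp_amplification[OF M M] h[OF st]])
    show "flip tens M (P s t x) = P s t x" if "x \<in> M" for x
      unfolding P_def using flip[OF st] amp[OF that] by (simp add: N_def)
  next
    fix s \<tau> t :: real and x assume s: "s \<in> {0} \<union> {1..}" and st: "1 \<le> \<tau> - s" "1 \<le> t - \<tau>" and x: "x \<in> M"
    have "map_tensor tens M (\<lambda>y. slice_map tens M (qqsp_state tens M P \<omega>\<^sub>0 s) (P s \<tau> y)) =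
        map_tensor tens M (Q s \<tau>)"
      using state[OF s] slice_P[OF s st(1)] by (intro map_tensor_cong) simp
    then show "P s t x = map_tensor tens M
        (\<lambda>y. slice_map tens M (qqsp_state tens M P \<omega>\<^sub>0 s) (P s \<tau> y)) (P \<tau> t x)"
      using evolution[of s \<tau> t "op_tensor tens x id"] s st amp[OF x] by (auto simp: P_def N_def)
  qed
  moreover have "Q s t x = slice_map tens M (\<phi> s) (P s t x)"
    if "s \<in> {0} \<union> {1..}" "1 \<le> t - s" "x \<in> M" for s t x
  proof -
    have "slice_map tens M (\<phi> s) = slice_map tens M (\<psi> s)"
      by (rule slice_map_cong) (rule \<phi>\<psi>[OF that(1)])
    then show ?thesis using slice_P[OF that] by simp
  qed
  ultimately show ?thesis using \<phi>\<psi> unfolding P_def by blast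
qed

end
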